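(* Let $2\le q<2_s^*$, $\lambda\in\mathbb R$, $a\in L^\infty(\Omega)$, $K,Q\in L^\infty(\Omega\times\Omega)$ and $f\in X^{-s}(\Omega)$. Set $$\eta=C_{S,2}^2\bigl(\|a\|_\infty+|\Omega|\,\|K\|_\infty\bigr),\qquad \gamma=|\lambda|\,\|Q\|_\infty C_{S,q}^{2q},\qquad C_{q,Q,S}=\|Q\|_\infty\left[(q-1)2^{q-2}+q2^{q-1}\right]C_{S,q}^{2q}.$$ Suppose that, for some $r>0$, $$\gamma r^{2q-2}+\frac{\|f\|_{X^{-s}}}{r}\le 1-\eta\qquad\text{and}\qquad \kappa_r:=\eta+|\lambda|C_{q,Q,S}\,r^{2q-2}<1.$$ Let $E_r=\{u\in X_0^s(\Omega):\|u\|_{X_0^s}\le r\}$. Then problem (P) has a unique weak solution $u^*$ in $E_r$. For every $u_0\in E_r$, the Picard iterates $u_{n+1}:=S(u_n)$, $n\ge 0$, remain in $E_r$ and converge strongly to $u^*$ in $X_0^s(\Omega)$. If $0<\kappa_r<1$, they satisfy $$\|u_n-u^*\|_{X_0^s}\le\frac{\kappa_r^n}{1-\kappa_r}\|u_1-u_0\|_{X_0^s},\qquad n\ge 0.$$ If $\kappa_r=0$, the iteration reaches $u^*$ after one step (that is, $u_1=u^*$).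
   Context: Throughout, $\Omega\subset\mathbb R^N$, $N\ge 2$, is a bounded domain with Lipschitz boundary, $s\in(0,1)$ and $2_s^*=\frac{2N}{N-2s}$. $X_0^s(\Omega)=\{u\in H^s(\mathbb R^N): u=0 \text{ a.e. in }\mathbb R^N\setminus\Omega\}$, with the form $$\mathcal E_s(u,v)=\frac{C_{N,s}}2\iint_{\mathbb R^{2N}}\frac{(u(x)-u(y))(v(x)-v(y))}{|x-y|^{N+2s}}\,dx\,dy,\qquad C_{N,s}=\frac{4^s s\,\Gamma(N/2+s)}{\pi^{N/2}\Gamma(1-s)},$$ and norm $\|u\|_{X_0^s}=\mathcal E_s(u,u)^{1/2}$, which makes it a Hilbert space. $X^{-s}(\Omega)$ is its dual, with the dual norm and pairing $\langle\cdot,\cdot\rangle$. For $1\le p\le 2_s^*$, $C_{S,p}>0$ denotes a fixed constant with $\|u\|_{L^p(\Omega)}\le C_{S,p}\|u\|_{X_0^s}$ for all $u\in X_0^s(\Omega)$. $\|K\|_\infty,\|Q\|_\infty$ are $L^\infty(\Omega\times\Omega)$ norms, $\|a\|_\infty$ is the $L^\infty(\Omega)$ norm, $|\Omega|$ is the Lebesgue measure. $(T_Ku)(x)=\int_\Omega K(x,y)u(y)\,dy$, $B_Q(u)(x)=\int_\Omega Q(x,y)|u(y)|^q\,dy$, $\mathcal N_Q(u)=|u|^{q-2}u\,B_Q(u)$ (with $|u|^{q-2}u:=0$ where $u=0$), and $$\mathcal A_s(u,v)=\mathcal E_s(u,v)-\int_\Omega (T_Ku)v\,dx-\int_\Omega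 a\,uv\,dx.$$ Problem (P) is: $(-\Delta)^su-T_Ku=au+\lambda\mathcal N_Q(u)+f$ in $\Omega$, $u=0$ in $\mathbb R^N\setminus\Omega$. A weak solution of (P) is a function $u\in X_0^s(\Omega)$ with $\mathcal A_s(u,\varphi)=\lambda\int_\Omega\mathcal N_Q(u)\varphi\,dx+\langle f,\varphi\rangle$ for every $\varphi\in X_0^s(\Omega)$. The solution operator $S:X_0^s(\Omega)\to X_0^s(\Omega)$: for $u\in X_0^s(\Omega)$, $S(u)$ is the unique element of $X_0^s(\Omega)$ with $$\mathcal E_s(S(u),\varphi)=\int_\Omega\bigl(au+T_Ku+\lambda\mathcal N_Q(u)\bigr)\varphi\,dx+\langle f,\varphi\rangle\qquad\text{for every }\varphi\in X_0^s(\Omega).$$ *)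

theory Defs
  imports "HOL-Analysis.Analysis" "HOL-Probability.Essential_Supremum"
begin

text \<open>
  The Euclidean space \<open>\<real>\<^sup>N\<close> is a type \<open>'a :: euclidean_space\<close> with \<open>N = DIM('a)\<close>. Elements of
  \<open>L\<^sup>p\<close> and Sobolev spaces are represented by Lebesgue measurable functions rather than by
  equivalence classes, so that equality of elements is equality almost everywhere.
\<close>

text \<open>
  Near each boundary point, \<open>\<Omega>\<close> is the strict epigraph, in some direction \<open>e\<close>, of a Lipschitz
  function on the hyperplane orthogonal to \<open>e\<close>. A Lipschitz function on a part of the hyperplane
  extends to all of it, so \<open>g\<close> may be taken globally Lipschitz.
\<close>
definition lipschitz_boundary :: "'a::euclidean_space set \<Rightarrow> bool" where
  "lipschitz_boundary \<Omega> \<longleftrightarrow>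
     (\<forall>x\<in>frontier \<Omega>. \<exists>U e g L. open U \<and> x \<in> U \<and> norm e = 1 \<and>
        L-lipschitz_on {y. y \<bullet> e = 0} g \<and>
        \<Omega> \<inter> U = {y\<in>U. g (y - (y \<bullet> e) *\<^sub>R e) < y \<bullet> e})"

definition bounded_lipschitz_domain :: "'a::euclidean_space set \<Rightarrow> bool" where
  "bounded_lipschitz_domain \<Omega> \<longleftrightarrow>
     open \<Omega> \<and> connected \<Omega> \<and> \<Omega> \<noteq> {} \<and> bounded \<Omega> \<and> lipschitz_boundary \<Omega>"

definition Lp_space :: "real \<Rightarrow> 'a::euclidean_space set \<Rightarrow> ('a \<Rightarrow> real) set" where
  "Lp_space p D = {u \<in> borel_measurable (lebesgue_on D).
     integrable (lebesgue_on D) (\<lambda>x. \<bar>u x\<bar> powr p)}"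

definition Lp_norm :: "real \<Rightarrow> 'a::euclidean_space set \<Rightarrow> ('a \<Rightarrow> real) \<Rightarrow> real" where
  "Lp_norm p D u = (LINT x|lebesgue_on D. \<bar>u x\<bar> powr p) powr (1 / p)"

definition Linf_space :: "'a::euclidean_space set \<Rightarrow> ('a \<Rightarrow> real) set" where
  "Linf_space D = {u \<in> borel_measurable (lebesgue_on D).
     esssup (lebesgue_on D) (\<lambda>x. ereal \<bar>u x\<bar>) < \<infinity>}"

definition Linf_norm :: "'a::euclidean_space set \<Rightarrow> ('a \<Rightarrow> real) \<Rightarrow> real" where
  "Linf_norm D u = real_of_ereal (esssup (lebesgue_on D) (\<lambda>x. ereal \<bar>u x\<bar>))"

text \<open>
  On the diagonal \<open>x = y\<close>, a null set, the quotients below are \<open>0\<close> because \<open>0 powr p = 0\<close> and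
  division by zero yields zero.
\<close>
definition Hs :: "real \<Rightarrow> ('a::euclidean_space \<Rightarrow> real) set" where
  "Hs s = {u \<in> Lp_space 2 UNIV.
     integrable lebesgue
       (\<lambda>(x::'a, y::'a). (u x - u y)\<^sup>2 / norm (x - y) powr (real DIM('a) + 2 * s))}"

definition X0s :: "real \<Rightarrow> 'a::euclidean_space set \<Rightarrow> ('a \<Rightarrow> real) set" where
  "X0s s \<Omega> = {u \<in> Hs s. AE x in lebesgue. x \<notin> \<Omega> \<longrightarrow> u x = 0}"

definition C_frac :: "nat \<Rightarrow> real \<Rightarrow> real" where
  "C_frac N s =
     4 powr s * s * Gamma (real N / 2 + s) / (pi powr (real N / 2) * Gamma (1 - s))"

definition Es :: "real \<Rightarrow> ('a::euclidean_space \<Rightarrow> real) \<Rightarrow> ('a \<Rightarrow> real) \<Rightarrow> real" where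
  "Es s u v = C_frac DIM('a) s / 2 *
     (LINT (x::'a, y::'a)|lebesgue.
        (u x - u y) * (v x - v y) / norm (x - y) powr (real DIM('a) + 2 * s))"

definition X0s_norm :: "real \<Rightarrow> ('a::euclidean_space \<Rightarrow> real) \<Rightarrow> real" where
  "X0s_norm s u = sqrt (Es s u u)"

definition X0s_ball :: "real \<Rightarrow> 'a::euclidean_space set \<Rightarrow> real \<Rightarrow> ('a \<Rightarrow> real) set" where
  "X0s_ball s \<Omega> r = {u \<in> X0s s \<Omega>. X0s_norm s u \<le> r}"

text \<open>
  Boundedness together with linearity makes a functional in the dual space agree on almost
  everywhere equal functions.
\<close>
definition X0s_dual :: "real \<Rightarrow> 'a::euclidean_space set \<Rightarrow> (('a \<Rightarrow> real) \<Rightarrow> real) set" where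
  "X0s_dual s \<Omega> = {f.
     (\<forall>u\<in>X0s s \<Omega>. \<forall>v\<in>X0s s \<Omega>. f (\<lambda>x. u x + v x) = f u + f v) \<and>
     (\<forall>c. \<forall>u\<in>X0s s \<Omega>. f (\<lambda>x. c * u x) = c * f u) \<and>
     (\<exists>C. \<forall>u\<in>X0s s \<Omega>. \<bar>f u\<bar> \<le> C * X0s_norm s u)}"

definition X0s_dual_norm ::
    "real \<Rightarrow> 'a::euclidean_space set \<Rightarrow> (('a \<Rightarrow> real) \<Rightarrow> real) \<Rightarrow> real" where
  "X0s_dual_norm s \<Omega> f = (SUP u\<in>X0s_ball s \<Omega> 1. \<bar>f u\<bar>)"

definition crit_exp :: "nat \<Rightarrow> real \<Rightarrow> real" where
  "crit_exp N s = 2 * real N / (real N - 2 * s)"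

text \<open>
  Membership in \<open>L\<^sup>p\<close> is stated explicitly: the Bochner integral of a non-integrable function
  is zero, so the norm inequality alone would not express finiteness of the \<open>L\<^sup>p\<close> norm.
\<close>
definition sobolev_constants ::
    "real \<Rightarrow> 'a::euclidean_space set \<Rightarrow> (real \<Rightarrow> real) \<Rightarrow> bool" where
  "sobolev_constants s \<Omega> CS \<longleftrightarrow>
     (\<forall>p. 1 \<le> p \<and> p \<le> crit_exp DIM('a) s \<longrightarrow> CS p > 0 \<and>
        (\<forall>u\<in>X0s s \<Omega>. u \<in> Lp_space p \<Omega> \<and> Lp_norm p \<Omega> u \<le> CS p * X0s_norm s u))"

definition TK :: "'a::euclidean_space set \<Rightarrow> ('a \<times> 'a \<Rightarrow> real) \<Rightarrow> ('a \<Rightarrow> real) \<Rightarrow> 'a \<Rightarrow> real" where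
  "TK \<Omega> K u x = (LINT y|lebesgue_on \<Omega>. K (x, y) * u y)"

definition BQ ::
    "'a::euclidean_space set \<Rightarrow> ('a \<times> 'a \<Rightarrow> real) \<Rightarrow> real \<Rightarrow> ('a \<Rightarrow> real) \<Rightarrow> 'a \<Rightarrow> real" where
  "BQ \<Omega> Q q u x = (LINT y|lebesgue_on \<Omega>. Q (x, y) * \<bar>u y\<bar> powr q)"

definition NQ ::
    "'a::euclidean_space set \<Rightarrow> ('a \<times> 'a \<Rightarrow> real) \<Rightarrow> real \<Rightarrow> ('a \<Rightarrow> real) \<Rightarrow> 'a \<Rightarrow> real" where
  "NQ \<Omega> Q q u x = \<bar>u x\<bar> powr (q - 2) * u x * BQ \<Omega> Q q u x"

definition As ::
    "real \<Rightarrow> 'a::euclidean_space set \<Rightarrow> ('a \<Rightarrow> real) \<Rightarrow> ('a \<times> 'a \<Rightarrow> real) \<Rightarrow>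
     ('a \<Rightarrow> real) \<Rightarrow> ('a \<Rightarrow> real) \<Rightarrow> real" where
  "As s \<Omega> a K u v =
     Es s u v - (LINT x|lebesgue_on \<Omega>. TK \<Omega> K u x * v x) - (LINT x|lebesgue_on \<Omega>. a x * u x * v x)"

definition weak_solution ::
    "real \<Rightarrow> 'a::euclidean_space set \<Rightarrow> ('a \<Rightarrow> real) \<Rightarrow> ('a \<times> 'a \<Rightarrow> real) \<Rightarrow> ('a \<times> 'a \<Rightarrow> real) \<Rightarrow>
     real \<Rightarrow> real \<Rightarrow> (('a \<Rightarrow> real) \<Rightarrow> real) \<Rightarrow> ('a \<Rightarrow> real) \<Rightarrow> bool" where
  "weak_solution s \<Omega> a K Q q lam f u \<longleftrightarrow> u \<in> X0s s \<Omega> \<and>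
     (\<forall>\<phi>\<in>X0s s \<Omega>.
        As s \<Omega> a K u \<phi> = lam * (LINT x|lebesgue_on \<Omega>. NQ \<Omega> Q q u x * \<phi> x) + f \<phi>)"

text \<open>
  The element is unique only up to equality almost everywhere, hence a representative is chosen.
\<close>
definition sol_op ::
    "real \<Rightarrow> 'a::euclidean_space set \<Rightarrow> ('a \<Rightarrow> real) \<Rightarrow> ('a \<times> 'a \<Rightarrow> real) \<Rightarrow> ('a \<times> 'a \<Rightarrow> real) \<Rightarrow>
     real \<Rightarrow> real \<Rightarrow> (('a \<Rightarrow> real) \<Rightarrow> real) \<Rightarrow> ('a \<Rightarrow> real) \<Rightarrow> ('a \<Rightarrow> real)" where
  "sol_op s \<Omega> a K Q q lam f u = (SOME w. w \<in> X0s s \<Omega> \<and>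
     (\<forall>\<phi>\<in>X0s s \<Omega>.
        Es s w \<phi> =
          (LINT x|lebesgue_on \<Omega>. (a x * u x + TK \<Omega> K u x + lam * NQ \<Omega> Q q u x) * \<phi> x) + f \<phi>))"

end

theory Submission
  imports Defs
begin

text \<open>
  \<open>X\<^sub>0\<^sup>s(\<Omega>)\<close> with the form \<open>\<E>\<^sub>s\<close> is complete: a sequence with summable increments converges almost
  everywhere, because the Sobolev inequality for \<open>p = 1\<close> makes the increments summable in \<open>L\<^sup>1\<close>, and
  Fatou's lemma turns this into convergence in norm. Hence the solution operator exists by Riesz'
  theorem. Testing its defining equation with \<open>S u\<close> and with \<open>S u - S v\<close>, Hoelder's inequality with
  exponents \<open>q/(q-2), q, q\<close>, together with
  \<open>\<bar>\<bar>u\<bar>\<^sup>q\<^sup>-\<^sup>2 u - \<bar>v\<bar>\<^sup>q\<^sup>-\<^sup>2 v\<bar> \<le> (q - 1) (\<bar>u\<bar> + \<bar>v\<bar>)\<^sup>q\<^sup>-\<^sup>2 \<bar>u - v\<bar>\<close> and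
  \<open>\<bar>\<bar>u\<bar>\<^sup>q - \<bar>v\<bar>\<^sup>q\<bar> \<le> q (\<bar>u\<bar> + \<bar>v\<bar>)\<^sup>q\<^sup>-\<^sup>1 \<bar>u - v\<bar>\<close>, shows that \<open>S\<close> maps \<open>E\<^sub>r\<close> into itself and is a
  \<open>\<kappa>\<^sub>r\<close>-contraction there, and Banach's fixed point argument applies.
\<close>

section \<open>Power inequalities\<close>

text \<open>Functions stand for their classes, so an image under the solution operator is fixed only
  up to a null set. The fixed point argument therefore uses a relation \<open>S u w\<close> between
  representatives, closed under changes of norm zero; the choice made in \<open>sol_op\<close> is
  one instance of it, and equality almost everywhere returns at the end because norm zero forces it.
  The two smallness conditions act separately: the first, multiplied by \<open>r\<close>, bounds the
  tested right-hand side by \<open>r\<close> times the norm of the test function; the second bounds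
  the Lipschitz constant. The nonlinear part of that constant comes from varying the two occurrences
  of \<open>u\<close> in \<open>NQ\<close> one at a time: the signed power contributes
  \<open>(q - 1) * 2 powr (q - 2)\<close>, the integral \<open>BQ\<close> contributes
  \<open>q * 2 powr (q - 1)\<close>. The powers of two arise because the \<open>L^q\<close> norm of
  \<open>\<bar>u\<bar> + \<bar>v\<bar>\<close> is at most twice the common bound. A further obstacle
  is measurability: kernels are measurable only for the completed product measure, so identities for
  the integral operators are available only almost everywhere.\<close>

lemma powr_diff_le:
  fixes x y p :: real
  assumes "1 \<le> p" "0 \<le> y" "y \<le> x"
  shows "x powr p - y powr p \<le> p * x powr (p - 1) * (x - y)"
proof (cases "y = 0 \<or> x = y")
  case True
  show ?thesis
  proof (cases "x = y")
    case False
    then have y: "y = 0" "x > 0" using True assms by auto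
    have "x powr p = x powr (p - 1) * x"
      using y powr_mult_base[of x "p - 1"] by (simp add: mult.commute)
    moreover have "x powr (p - 1) * x * 1 \<le> x powr (p - 1) * x * p"
      using y assms by (intro mult_left_mono) auto
    ultimately show ?thesis using y by (simp add: mult_ac)
  qed simp
next
  case False
  then have y: "0 < y" "y < x" using assms by auto
  \<comment> \<open>The power rule is used at positive points only, which is why
    \<open>y = 0\<close> was split off. The derivative is increasing because
    \<open>p - 1 \<ge> 0\<close>, so it is at most its value at \<open>x\<close>.\<close>
  have "\<exists>z. y < z \<and> z < x \<and> x powr p - y powr p = (x - y) * (p * z powr (p - 1))"
    using y by (intro MVT2) (auto intro!: derivative_eq_intros simp: powr_diff)
  then obtain z where z: "y < z" "z < x" "x powr p - y powr p = (x - y) * (p * z powr (p - 1))"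
    by blast
  have "z powr (p - 1) \<le> x powr (p - 1)"
    using z y assms by (intro powr_mono2) auto
  then have "(x - y) * (p * z powr (p - 1)) \<le> (x - y) * (p * x powr (p - 1))"
    using y assms by (intro mult_left_mono) auto
  then show ?thesis using z by (simp add: mult_ac)
qed

lemma abs_powr_diff_le:
  fixes u v p :: real
  assumes "1 \<le> p"
  shows "\<bar>\<bar>u\<bar> powr p - \<bar>v\<bar> powr p\<bar> \<le> p * (\<bar>u\<bar> + \<bar>v\<bar>) powr (p - 1) * \<bar>u - v\<bar>"
proof -
  have main: "\<bar>\<bar>u\<bar> powr p - \<bar>v\<bar> powr p\<bar> \<le> p * (\<bar>u\<bar> + \<bar>v\<bar>) powr (p - 1) * \<bar>u - v\<bar>"
    if "\<bar>v\<bar> \<le> \<bar>u\<bar>" for u v :: real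
  proof -
    have "\<bar>v\<bar> powr p \<le> \<bar>u\<bar> powr p"
      using that assms by (intro powr_mono2) auto
    then have "\<bar>\<bar>u\<bar> powr p - \<bar>v\<bar> powr p\<bar> \<le> p * \<bar>u\<bar> powr (p - 1) * (\<bar>u\<bar> - \<bar>v\<bar>)"
      using powr_diff_le[of p "\<bar>v\<bar>" "\<bar>u\<bar>"] that assms by auto
    also have "\<dots> \<le> p * (\<bar>u\<bar> + \<bar>v\<bar>) powr (p - 1) * \<bar>u - v\<bar>"
      using assms that by (intro mult_mono powr_mono2) auto
    finally show ?thesis .
  qed
  show ?thesis
  proof (cases "\<bar>v\<bar> \<le> \<bar>u\<bar>")
    case False
    then show ?thesis using main[of u v]
      by (metis abs_minus_commute add.commute linear main)
  qed (use main in auto)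
qed

lemma abs_powr_mult_abs:
  fixes x p :: real
  assumes "p > 0"
  shows "\<bar>x\<bar> powr (p - 1) * \<bar>x\<bar> = \<bar>x\<bar> powr p"
proof (cases "x = 0")
  case False
  then show ?thesis using powr_mult_base[of "\<bar>x\<bar>" "p - 1"] by (simp add: mult.commute)
qed simp

text \<open>For equal signs the signed powers differ like the powers \<open>q - 1\<close> of the
  absolute values. For opposite signs nothing cancels, but then
  \<open>\<bar>u\<bar> + \<bar>v\<bar> = \<bar>u - v\<bar>\<close>, and the triangle inequality
  already suffices because \<open>q - 1 \<ge> 1\<close>.\<close>

lemma signed_powr_diff_le:
  fixes u v q :: real
  assumes q: "2 \<le> q"
  shows "\<bar>\<bar>u\<bar> powr (q - 2) * u - \<bar>v\<bar> powr (q - 2) * v\<bar>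
    \<le> (q - 1) * (\<bar>u\<bar> + \<bar>v\<bar>) powr (q - 2) * \<bar>u - v\<bar>"
proof (cases "u * v \<ge> 0")
  case True
  have *: "\<bar>x\<bar> powr (q - 2) * \<bar>x\<bar> = \<bar>x\<bar> powr (q - 1)" for x
    using abs_powr_mult_abs[of "q - 1" x] q by simp
  have "\<bar>\<bar>u\<bar> powr (q - 2) * u - \<bar>v\<bar> powr (q - 2) * v\<bar>
    = \<bar>\<bar>u\<bar> powr (q - 2) * \<bar>u\<bar> - \<bar>v\<bar> powr (q - 2) * \<bar>v\<bar>\<bar>"
    using True by (auto simp: zero_le_mult_iff abs_minus_commute)
  then show ?thesis
    using abs_powr_diff_le[of "q - 1" u v] q unfolding * by simp
next
  case False
  have le: "\<bar>x\<bar> powr (q - 2) * \<bar>x\<bar> \<le> (\<bar>u\<bar> + \<bar>v\<bar>) powr (q - 2) * \<bar>x\<bar>" if "x \<in> {u, v}" for x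
    using that q by (intro mult_right_mono powr_mono2) auto
  have "\<bar>\<bar>u\<bar> powr (q - 2) * u - \<bar>v\<bar> powr (q - 2) * v\<bar>
      \<le> \<bar>u\<bar> powr (q - 2) * \<bar>u\<bar> + \<bar>v\<bar> powr (q - 2) * \<bar>v\<bar>"
    by (rule order_trans[OF abs_triangle_ineq4]) (simp add: abs_mult)
  also have "\<dots> \<le> (\<bar>u\<bar> + \<bar>v\<bar>) powr (q - 2) * \<bar>u\<bar> + (\<bar>u\<bar> + \<bar>v\<bar>) powr (q - 2) * \<bar>v\<bar>"
    by (intro add_mono le) auto
  also have "\<dots> = (\<bar>u\<bar> + \<bar>v\<bar>) powr (q - 2) * \<bar>u - v\<bar>"
    using False by (auto simp: zero_le_mult_iff algebra_simps)
  also have "\<dots> \<le> (q - 1) * ((\<bar>u\<bar> + \<bar>v\<bar>) powr (q - 2) * \<bar>u - v\<bar>)"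
    using q mult_right_mono[of 1 "q - 1" "(\<bar>u\<bar> + \<bar>v\<bar>) powr (q - 2) * \<bar>u - v\<bar>"] by simp
  finally show ?thesis by (simp add: mult_ac)
qed

text \<open>Young's inequality with weights \<open>(q - 2) / q\<close>, \<open>1 / q\<close>,
  \<open>1 / q\<close>. It is reduced to two factors by
  \<open>y * z \<le> (y\<^sup>2 + z\<^sup>2) / 2\<close>; the endpoint \<open>q = 2\<close>, where
  the first weight vanishes, is included.\<close>

lemma powr_mult_mult_le:
  fixes x y z q :: real
  assumes q: "2 \<le> q" and nn: "0 \<le> x" "0 \<le> y" "0 \<le> z"
  shows "x powr (q - 2) * (y * z) \<le> ((q - 2) * x powr q + y powr q + z powr q) / q"
proof -
  have *: "x powr (q - 2) * t\<^sup>2 \<le> ((q - 2) * x powr q + 2 * t powr q) / q" if "0 \<le> t" for t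
  proof (cases "x = 0 \<or> t = 0")
    case True
    then show ?thesis using q by auto
  next
    case False
    then have pos: "x > 0" "t > 0" using nn that by auto
    have e: "(q - 2) / q + 2 / q = 1" using q by (simp add: field_simps)
    have "(x powr q) powr ((q - 2) / q) * (t powr q) powr (2 / q)
        \<le> (q - 2) / q * x powr q + 2 / q * t powr q"
      using q pos e by (intro Youngs_inequality_0) auto
    moreover have "(x powr q) powr ((q - 2) / q) = x powr (q - 2)"
      using q by (simp add: powr_powr)
    moreover have "(t powr q) powr (2 / q) = t\<^sup>2"
      using q pos by (simp add: powr_powr)
    ultimately show ?thesis
      by (simp add: add_divide_distrib)
  qed
  have "y * z \<le> (y\<^sup>2 + z\<^sup>2) / 2"
    using sum_squares_bound[of y z] by simp
  then have "x powr (q - 2) * (y * z) \<le> x powr (q - 2) * ((y\<^sup>2 + z\<^sup>2) / 2)"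
    by (intro mult_left_mono) auto
  also have "\<dots> = (x powr (q - 2) * y\<^sup>2 + x powr (q - 2) * z\<^sup>2) / 2"
    by (simp add: algebra_simps)
  also have "\<dots> \<le> (((q - 2) * x powr q + 2 * y powr q) / q
      + ((q - 2) * x powr q + 2 * z powr q) / q) / 2"
    using *[of y] *[of z] nn by (intro divide_right_mono add_mono) auto
  also have "\<dots> = ((q - 2) * x powr q + y powr q + z powr q) / q"
    using q by (simp add: field_simps)
  finally show ?thesis .
qed

text \<open>Convexity of the power function at the midpoint \<open>m\<close>, proved by the
  supporting line there. For \<open>m = 0\<close> the slope \<open>0 powr (p - 1)\<close> is
  \<open>0\<close> by default even when \<open>p = 1\<close>, so the line is the zero
  function.\<close>

lemma powr_add_le:
  fixes x y p :: real
  assumes p: "1 \<le> p" and nn: "0 \<le> x" "0 \<le> y"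
  shows "(x + y) powr p \<le> 2 powr p * ((x powr p + y powr p) / 2)"
proof -
  define m where "m = (x + y) / 2"
  have tangent: "t powr p \<ge> m powr p + p * m powr (p - 1) * (t - m)" if "0 \<le> t" for t
  proof (cases "t \<le> m")
    case True
    then show ?thesis using powr_diff_le[of p t m] p that by (simp add: algebra_simps)
  next
    case False
    show ?thesis
    proof (cases "m = 0")
      case True
      then show ?thesis by simp
    next
      case m0: False
      then have m: "0 < m" "m < t" using False nn by (auto simp: m_def)
      have "\<exists>z. m < z \<and> z < t \<and> t powr p - m powr p = (t - m) * (p * z powr (p - 1))"
        using m by (intro MVT2) (auto intro!: derivative_eq_intros simp: powr_diff)
      then obtain z where z: "m < z" "z < t" "t powr p - m powr p = (t - m) * (p * z powr (p - 1))"
        by blast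
      have "m powr (p - 1) \<le> z powr (p - 1)"
        using z m p by (intro powr_mono2) auto
      then have "(t - m) * (p * m powr (p - 1)) \<le> (t - m) * (p * z powr (p - 1))"
        using m p by (intro mult_left_mono) auto
      then show ?thesis using z by (simp add: mult_ac)
    qed
  qed
  \<comment> \<open>The supporting line is evaluated at both endpoints; the linear terms cancel
    because \<open>m\<close> is their mean.\<close>
  have "x powr p + y powr p \<ge> 2 * m powr p + p * m powr (p - 1) * (x + y - 2 * m)"
    using tangent[of x] tangent[of y] nn by (simp add: algebra_simps)
  moreover have "x + y - 2 * m = 0"
    by (simp add: m_def)
  ultimately have "m powr p \<le> (x powr p + y powr p) / 2"
    by simp
  moreover have "(x + y) powr p = 2 powr p * m powr p"
  proof -
    have "x + y = 2 * m" "0 \<le> m" using nn by (auto simp: m_def)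
    then show ?thesis by (simp add: powr_mult)
  qed
  ultimately show ?thesis by simp
qed

section \<open>Hoelder inequalities\<close>

text \<open>A norm bound without roots. The number \<open>b\<close> need not be the norm itself: it
  is usually a Sobolev constant times a norm or a radius, and may be enlarged.\<close>

definition Lp_le :: "'b measure \<Rightarrow> real \<Rightarrow> real \<Rightarrow> ('b \<Rightarrow> real) \<Rightarrow> bool" where
  "Lp_le M p b u \<longleftrightarrow> u \<in> borel_measurable M \<and> integrable M (\<lambda>x. \<bar>u x\<bar> powr p) \<and>
     (LINT x|M. \<bar>u x\<bar> powr p) \<le> b powr p"

lemma Lp_leD:
  assumes "Lp_le M p b u"
  shows "u \<in> borel_measurable M" "integrable M (\<lambda>x. \<bar>u x\<bar> powr p)"
    "(LINT x|M. \<bar>u x\<bar> powr p) \<le> b powr p"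
  using assms by (auto simp: Lp_le_def)

lemma Lp_le_mono:
  assumes "Lp_le M p b u" "0 \<le> b" "b \<le> c" "0 \<le> p"
  shows "Lp_le M p c u"
  using assms powr_mono2[of p b c] by (auto simp: Lp_le_def)

text \<open>With one common bound \<open>b\<close>, convexity replaces Minkowski's inequality. The
  factor \<open>2\<close> produced here is the source of the powers of two in the contraction
  constant.\<close>

lemma Lp_le_abs_add:
  assumes p: "1 \<le> p" and u: "Lp_le M p b u" and v: "Lp_le M p b v" and b: "0 \<le> b"
  shows "Lp_le M p (2 * b) (\<lambda>x. \<bar>u x\<bar> + \<bar>v x\<bar>)"
proof -
  note [measurable] = Lp_leD(1)[OF u] Lp_leD(1)[OF v]
  note int = Lp_leD(2)[OF u] Lp_leD(2)[OF v]
  have bound: "(\<bar>u x\<bar> + \<bar>v x\<bar>) powr p \<le> 2 powr p * ((\<bar>u x\<bar> powr p + \<bar>v x\<bar> powr p) / 2)" for x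
    using p by (intro powr_add_le) auto
  have int': "integrable M (\<lambda>x. 2 powr p * ((\<bar>u x\<bar> powr p + \<bar>v x\<bar> powr p) / 2))"
    using int by auto
  then have i: "integrable M (\<lambda>x. (\<bar>u x\<bar> + \<bar>v x\<bar>) powr p)"
    by (rule Bochner_Integration.integrable_bound) (use bound in auto)
  have "(LINT x|M. (\<bar>u x\<bar> + \<bar>v x\<bar>) powr p)
      \<le> (LINT x|M. 2 powr p * ((\<bar>u x\<bar> powr p + \<bar>v x\<bar> powr p) / 2))"
    by (intro integral_mono i int' bound)
  also have "\<dots> = 2 powr p * (((LINT x|M. \<bar>u x\<bar> powr p) + (LINT x|M. \<bar>v x\<bar> powr p)) / 2)"
    using int by simp
  also have "\<dots> \<le> 2 powr p * b powr p"
    using Lp_leD(3)[OF u] Lp_leD(3)[OF v] by (intro mult_left_mono) auto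
  also have "\<dots> = (2 * b) powr p"
    using b by (simp add: powr_mult)
  finally show ?thesis
    using i by (auto simp: Lp_le_def)
qed

text \<open>Dividing the functions by their bounds and integrating Young's inequality gives total
  weight \<open>((q - 2) + 1 + 1) / q = 1\<close>. Since \<open>b\<close> and \<open>c\<close> may
  be zero, the division uses \<open>b + e\<close> and \<open>c + e\<close>, and \<open>e\<close>
  then tends to zero.\<close>

lemma Holder_three:
  assumes q: "2 \<le> q" and a: "0 < a" and b: "0 \<le> b" and c: "0 \<le> c"
    and u: "Lp_le M q a u" and v: "Lp_le M q b v" and w: "Lp_le M q c w"
  shows "integrable M (\<lambda>x. \<bar>u x\<bar> powr (q - 2) * (\<bar>v x\<bar> * \<bar>w x\<bar>))"
    and "(LINT x|M. \<bar>u x\<bar> powr (q - 2) * (\<bar>v x\<bar> * \<bar>w x\<bar>)) \<le> a powr (q - 2) * (b * c)"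
proof -
  note [measurable] = Lp_leD(1)[OF u] Lp_leD(1)[OF v] Lp_leD(1)[OF w]
  note int = Lp_leD(2)[OF u] Lp_leD(2)[OF v] Lp_leD(2)[OF w]
  define F where "F = (\<lambda>x. \<bar>u x\<bar> powr (q - 2) * (\<bar>v x\<bar> * \<bar>w x\<bar>))"
  define G where "G = (\<lambda>b c x. a powr (q - 2) * (b * c) * (((q - 2) * (\<bar>u x\<bar> powr q / a powr q)
      + \<bar>v x\<bar> powr q / b powr q + \<bar>w x\<bar> powr q / c powr q) / q))"
  have Fnn: "F x \<ge> 0" for x by (simp add: F_def)
  have FG: "F x \<le> G b c x" if "b > 0" "c > 0" for b c x
  proof -
    have "F x = a powr (q - 2) * (b * c) * ((\<bar>u x\<bar> / a) powr (q - 2) * ((\<bar>v x\<bar> / b) * (\<bar>w x\<bar> / c)))"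
      using a that by (simp add: F_def powr_divide)
    also have "\<dots> \<le> a powr (q - 2) * (b * c) * (((q - 2) * (\<bar>u x\<bar> / a) powr q
      + (\<bar>v x\<bar> / b) powr q + (\<bar>w x\<bar> / c) powr q) / q)"
      using a that q by (intro mult_left_mono powr_mult_mult_le) auto
    also have "\<dots> = G b c x"
      using a that by (simp add: G_def powr_divide)
    finally show ?thesis .
  qed
  have intG: "integrable M (G b c)" for b c
    unfolding G_def using int by auto
  \<comment> \<open>Any positive scales give an integrable majorant; the actual bounds matter only
    for the constant.\<close>
  have intF: "integrable M F"
    by (rule Bochner_Integration.integrable_bound[OF intG[of 1 1]])
      (use FG[of 1 1] Fnn in \<open>auto simp: F_def intro!: AE_I2\<close>, smt (verit))
  show "integrable M (\<lambda>x. \<bar>u x\<bar> powr (q - 2) * (\<bar>v x\<bar> * \<bar>w x\<bar>))"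
    using intF by (simp add: F_def)
  have le: "integral\<^sup>L M F \<le> a powr (q - 2) * ((b + e) * (c + e))" if e: "e > 0" for e
  proof -
    have pos: "b + e > 0" "c + e > 0" using b c e by auto
    have "integral\<^sup>L M F \<le> integral\<^sup>L M (G (b + e) (c + e))"
      by (intro integral_mono intF intG FG pos)
    also have "\<dots> = a powr (q - 2) * ((b + e) * (c + e)) *
       (((q - 2) * ((LINT x|M. \<bar>u x\<bar> powr q) / a powr q)
      + (LINT x|M. \<bar>v x\<bar> powr q) / (b + e) powr q + (LINT x|M. \<bar>w x\<bar> powr q) / (c + e) powr q) / q)"
      unfolding G_def using int by simp
    also have "\<dots> \<le> a powr (q - 2) * ((b + e) * (c + e)) * (((q - 2) * 1 + 1 + 1) / q)"
    proof (intro mult_left_mono divide_right_mono add_mono)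
      show "(LINT x|M. \<bar>u x\<bar> powr q) / a powr q \<le> 1"
        using Lp_leD(3)[OF u] a by (simp add: divide_le_eq)
      show "(LINT x|M. \<bar>v x\<bar> powr q) / (b + e) powr q \<le> 1"
        using Lp_leD(3)[OF Lp_le_mono[OF v, of "b + e"]] b e q pos by (simp add: divide_le_eq)
      show "(LINT x|M. \<bar>w x\<bar> powr q) / (c + e) powr q \<le> 1"
        using Lp_leD(3)[OF Lp_le_mono[OF w, of "c + e"]] c e q pos by (simp add: divide_le_eq)
    qed (use q b c e in auto)
    finally show ?thesis using q by simp
  qed
  have "((\<lambda>e. a powr (q - 2) * ((b + e) * (c + e))) \<longlongrightarrow> a powr (q - 2) * ((b + 0) * (c + 0))) (at_right 0)"
    by (intro tendsto_intros)
  moreover have "eventually (\<lambda>e. integral\<^sup>L M F \<le> a powr (q - 2) * ((b + e) * (c + e))) (at_right 0)"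
    using le eventually_at_right_less[of "0::real"] by (auto elim: eventually_mono)
  ultimately have "integral\<^sup>L M F \<le> a powr (q - 2) * ((b + 0) * (c + 0))"
    by (rule tendsto_lowerbound) simp
  then show "(LINT x|M. \<bar>u x\<bar> powr (q - 2) * (\<bar>v x\<bar> * \<bar>w x\<bar>)) \<le> a powr (q - 2) * (b * c)"
    by (simp add: F_def)
qed

lemma Holder_powr:
  assumes q: "2 \<le> q" and a: "0 < a" and c: "0 \<le> c"
    and u: "Lp_le M q a u" and w: "Lp_le M q c w"
  shows "integrable M (\<lambda>x. \<bar>u x\<bar> powr (q - 1) * \<bar>w x\<bar>)"
    and "(LINT x|M. \<bar>u x\<bar> powr (q - 1) * \<bar>w x\<bar>) \<le> a powr (q - 1) * c"
proof -
  have e: "\<bar>x\<bar> powr (q - 2) * (\<bar>x\<bar> * y) = \<bar>x\<bar> powr (q - 1) * y" for x y :: real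
    using abs_powr_mult_abs[of "q - 1" x] q by (simp flip: mult.assoc)
  have ea: "a powr (q - 2) * (a * c) = a powr (q - 1) * c"
    using e[of a c] a by simp
  show "integrable M (\<lambda>x. \<bar>u x\<bar> powr (q - 1) * \<bar>w x\<bar>)"
    using Holder_three(1)[OF q a _ c u u w] a unfolding e by simp
  show "(LINT x|M. \<bar>u x\<bar> powr (q - 1) * \<bar>w x\<bar>) \<le> a powr (q - 1) * c"
    using Holder_three(2)[OF q a _ c u u w] a unfolding e ea by simp
qed

lemma Cauchy_Schwarz_Lp_le:
  assumes b: "0 \<le> b" and c: "0 \<le> c" and v: "Lp_le M 2 b v" and w: "Lp_le M 2 c w"
  shows "integrable M (\<lambda>x. \<bar>v x\<bar> * \<bar>w x\<bar>)"
    and "(LINT x|M. \<bar>v x\<bar> * \<bar>w x\<bar>) \<le> b * c"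
proof -
  \<comment> \<open>The first slot requires a positive bound. Its exponent is \<open>2 - 2\<close>,
    so the enlarged bound contributes only \<open>(b + 1) powr 0 = 1\<close>.\<close>
  have v1: "Lp_le M 2 (b + 1) v"
    using Lp_le_mono[OF v] b by simp
  \<comment> \<open>Since \<open>0 powr 0\<close> is \<open>0\<close>, the weight is not identically
    \<open>1\<close>. Putting \<open>v\<close> itself in the first slot makes the product vanish
    wherever the weight does.\<close>
  have e: "\<bar>x\<bar> powr (2 - 2) * (\<bar>x\<bar> * y) = \<bar>x\<bar> * y" for x y :: real
    by (cases "x = 0") auto
  show "integrable M (\<lambda>x. \<bar>v x\<bar> * \<bar>w x\<bar>)"
    using Holder_three(1)[OF _ _ b c v1 v w] b unfolding e by simp
  show "(LINT x|M. \<bar>v x\<bar> * \<bar>w x\<bar>) \<le> b * c"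
    using Holder_three(2)[OF _ _ b c v1 v w] b unfolding e by simp
qed

section \<open>Essentially bounded coefficients and kernels\<close>

text \<open>On a domain of measure zero the essential supremum is minus infinity, which
  \<open>real_of_ereal\<close> sends to \<open>0\<close>; hence the separate case.\<close>

lemma Linf_norm_nonneg:
  assumes "u \<in> Linf_space D"
  shows "0 \<le> Linf_norm D u"
proof (cases "emeasure (lebesgue_on D) (space (lebesgue_on D)) = 0")
  case True
  have "u \<in> borel_measurable (lebesgue_on D)"
    using assms by (simp add: Linf_space_def)
  then have "(\<lambda>x. ereal \<bar>u x\<bar>) \<in> borel_measurable (lebesgue_on D)"
    by measurable
  then have "esssup (lebesgue_on D) (\<lambda>x. ereal \<bar>u x\<bar>) = - \<infinity>"
    by (rule esssup_zero_space[OF True])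
  then show ?thesis
    by (simp add: Linf_norm_def)
next
  case False
  have "esssup (lebesgue_on D) (\<lambda>x. 0) \<le> esssup (lebesgue_on D) (\<lambda>x. ereal \<bar>u x\<bar>)"
    by (intro esssup_mono) simp_all
  then have "0 \<le> esssup (lebesgue_on D) (\<lambda>x. ereal \<bar>u x\<bar>)"
    using esssup_const[OF False, of 0] by metis
  then show ?thesis
    unfolding Linf_norm_def by (rule real_of_ereal_pos)
qed

lemma AE_Linf_norm:
  assumes "u \<in> Linf_space D"
  shows "AE x in lebesgue_on D. \<bar>u x\<bar> \<le> Linf_norm D u"
  using esssup_AE[of "\<lambda>x. ereal \<bar>u x\<bar>" "lebesgue_on D"]
proof eventually_elim
  case (elim x)
  have "esssup (lebesgue_on D) (\<lambda>x. ereal \<bar>u x\<bar>) < \<infinity>"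
    using assms by (simp add: Linf_space_def)
  with elim show ?case
    unfolding Linf_norm_def by (cases "esssup (lebesgue_on D) (\<lambda>x. ereal \<bar>u x\<bar>)") simp_all
qed

text \<open>Completeness of Lebesgue measure, transferred to \<open>D\<close>: after multiplication
  by the indicator of \<open>D\<close> the two functions agree almost everywhere in the whole
  space.\<close>

lemma borel_measurable_lebesgue_on_AE:
  fixes g h :: "'a::euclidean_space \<Rightarrow> real"
  assumes D: "D \<in> sets lebesgue" and g: "g \<in> borel_measurable (lebesgue_on D)"
    and ae: "AE x in lebesgue_on D. g x = h x"
  shows "h \<in> borel_measurable (lebesgue_on D)"
proof -
  have D': "D \<inter> space lebesgue \<in> sets lebesgue" using D by simp
  have "AE x in lebesgue. x \<in> D \<longrightarrow> g x = h x"
    using ae unfolding AE_restrict_space_iff[OF D'] .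
  then have ae': "AE x in lebesgue. indicator D x *\<^sub>R g x = indicator D x *\<^sub>R h x"
    by eventually_elim (simp split: split_indicator)
  have "(\<lambda>x. indicator D x *\<^sub>R g x) \<in> borel_measurable lebesgue"
    using g unfolding borel_measurable_restrict_space_iff[OF D'] .
  then have "(\<lambda>x. indicator D x *\<^sub>R h x) \<in> borel_measurable lebesgue"
    using ae' by (rule borel_measurable_AE)
  then show ?thesis
    unfolding borel_measurable_restrict_space_iff[OF D'] .
qed

text \<open>
  A kernel is only Lebesgue measurable on the product, so its sections are measurable for almost
  every point only; passing to a bounded Borel representative makes Fubini's theorem applicable.
\<close>

lemma Linf_kernel_representative:
  fixes K :: "'a::euclidean_space \<times> 'a \<Rightarrow> real"
  assumes D: "open D" and K: "K \<in> Linf_space (D \<times> D)"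
  obtains K' where "K' \<in> borel_measurable borel" "\<And>z. \<bar>K' z\<bar> \<le> Linf_norm (D \<times> D) K"
    "AE x in lebesgue_on D. AE y in lebesgue_on D. K (x, y) = K' (x, y)"
proof -
  define k where "k = Linf_norm (D \<times> D) K"
  have k: "0 \<le> k" unfolding k_def by (rule Linf_norm_nonneg[OF K])
  have DD: "D \<times> D \<in> sets lebesgue" and D': "D \<in> sets lebesgue"
    using D by (auto intro: lmeasurable_open simp: open_Times)
  have "(\<lambda>z. indicator (D \<times> D) z *\<^sub>R K z) \<in> borel_measurable lebesgue"
    using K DD by (simp add: borel_measurable_restrict_space_iff Linf_space_def)
  then obtain K0 where K0: "K0 \<in> borel_measurable lborel"
      "AE z in lborel. indicator (D \<times> D) z *\<^sub>R K z = K0 z"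
    using completion_ex_borel_measurable_real by blast
  \<comment> \<open>Truncation upgrades the almost everywhere bound to a bound at every point and
    changes nothing where \<open>K0\<close> already respects it.\<close>
  define K' where "K' = (\<lambda>z. max (- k) (min k (K0 z)))"
  have m: "K' \<in> borel_measurable borel"
    using K0(1) unfolding K'_def by simp
  have b: "\<bar>K' z\<bar> \<le> k" for z using k by (auto simp: K'_def)
  have "AE z in lebesgue. z \<in> D \<times> D \<longrightarrow> \<bar>K z\<bar> \<le> k"
    using AE_Linf_norm[OF K] DD by (simp add: AE_restrict_space_iff k_def)
  then have "AE z in lborel. z \<in> D \<times> D \<longrightarrow> \<bar>K z\<bar> \<le> k"
    by (simp add: AE_completion_iff)
  with K0(2) have "AE z in lborel. z \<in> D \<times> D \<longrightarrow> K z = K' z"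
    by eventually_elim (auto simp: K'_def)
  then have "AE z in (lborel \<Otimes>\<^sub>M lborel :: ('a \<times> 'a) measure). z \<in> D \<times> D \<longrightarrow> K z = K' z"
    unfolding lborel_prod .
  then have "AE x in lborel. AE y in lborel. (x, y) \<in> D \<times> D \<longrightarrow> K (x, y) = K' (x, y)"
    by (rule lborel_pair.AE_pair)
  then have "AE x in lebesgue. x \<in> D \<longrightarrow> (AE y in lebesgue. y \<in> D \<longrightarrow> K (x, y) = K' (x, y))"
    by (auto simp: AE_completion_iff elim!: eventually_mono)
  then have "AE x in lebesgue_on D. AE y in lebesgue_on D. K (x, y) = K' (x, y)"
    using D' by (simp add: AE_restrict_space_iff)
  with that m b show ?thesis by (simp add: k_def)
qed

section \<open>Sections of a kernel and its integral operator\<close>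

context
  fixes D :: "'a::euclidean_space set" and K :: "'a \<times> 'a \<Rightarrow> real"
  assumes D: "open D" "bounded D" and K: "K \<in> Linf_space (D \<times> D)"
begin

lemma AE_kernel_section:
  "AE x in lebesgue_on D. (\<lambda>y. K (x, y)) \<in> borel_measurable (lebesgue_on D) \<and>
     (AE y in lebesgue_on D. \<bar>K (x, y)\<bar> \<le> Linf_norm (D \<times> D) K)"
proof -
  have D': "D \<in> sets lebesgue" using D by (auto intro: lmeasurable_open)
  obtain K' where K': "K' \<in> borel_measurable borel" "\<And>z. \<bar>K' z\<bar> \<le> Linf_norm (D \<times> D) K"
    "AE x in lebesgue_on D. AE y in lebesgue_on D. K (x, y) = K' (x, y)"
    using Linf_kernel_representative[OF D(1) K] by blast
  have sec: "(\<lambda>y. K' (x, y)) \<in> borel_measurable (lebesgue_on D)" for x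
  proof -
    have "(\<lambda>y. K' (x, y)) \<in> borel_measurable borel"
      using measurable_compose[OF _ K'(1), of "Pair x" borel] by simp
    then show ?thesis
      by (simp add: measurable_restrict_space1 measurable_completion)
  qed
  show ?thesis using K'(3)
  proof eventually_elim
    case (elim x)
    have "(\<lambda>y. K (x, y)) \<in> borel_measurable (lebesgue_on D)"
      by (rule borel_measurable_lebesgue_on_AE[OF D' sec[of x]]) (use elim in auto)
    moreover have "AE y in lebesgue_on D. \<bar>K (x, y)\<bar> \<le> Linf_norm (D \<times> D) K"
      using elim by eventually_elim (simp add: K'(2))
    ultimately show ?case by blast
  qed
qed

text \<open>The quantifier over \<open>w\<close> stands inside \<open>AE\<close>, so the exceptional
  set depends on the kernel alone. At a good point the statement can therefore be used for several
  functions at once.\<close>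

lemma AE_integrable_kernel_mult:
  "AE x in lebesgue_on D. \<forall>w. integrable (lebesgue_on D) w \<longrightarrow>
     integrable (lebesgue_on D) (\<lambda>y. K (x, y) * w y) \<and>
     \<bar>TK D K w x\<bar> \<le> Linf_norm (D \<times> D) K * (LINT y|lebesgue_on D. \<bar>w y\<bar>)"
  using AE_kernel_section
proof eventually_elim
  case (elim x)
  define k where "k = Linf_norm (D \<times> D) K"
  have k: "0 \<le> k" unfolding k_def by (rule Linf_norm_nonneg[OF K])
  show ?case
  proof (intro allI impI)
    fix w :: "'a \<Rightarrow> real"
    assume w: "integrable (lebesgue_on D) w"
    have m: "(\<lambda>y. K (x, y) * w y) \<in> borel_measurable (lebesgue_on D)"
      using elim w by (intro borel_measurable_times) auto
    have ae: "AE y in lebesgue_on D. \<bar>K (x, y) * w y\<bar> \<le> k * \<bar>w y\<bar>"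
      using conjunct2[OF elim] by eventually_elim (auto simp: abs_mult k_def intro: mult_right_mono)
    have ikw: "integrable (lebesgue_on D) (\<lambda>y. k * \<bar>w y\<bar>)" using w by simp
    have i: "integrable (lebesgue_on D) (\<lambda>y. K (x, y) * w y)"
      by (rule Bochner_Integration.integrable_bound[OF ikw m]) (use ae k in auto)
    have "\<bar>TK D K w x\<bar> \<le> (LINT y|lebesgue_on D. \<bar>K (x, y) * w y\<bar>)"
      unfolding TK_def by (rule integral_abs_bound)
    also have "\<dots> \<le> (LINT y|lebesgue_on D. k * \<bar>w y\<bar>)"
      by (rule integral_mono_AE) (use i ikw ae in auto)
    finally show "integrable (lebesgue_on D) (\<lambda>y. K (x, y) * w y) \<and>
      \<bar>TK D K w x\<bar> \<le> Linf_norm (D \<times> D) K * (LINT y|lebesgue_on D. \<bar>w y\<bar>)"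
      using i by (simp add: k_def)
  qed
qed

lemma AE_abs_TK_le:
  assumes "integrable (lebesgue_on D) w"
  shows "AE x in lebesgue_on D. \<bar>TK D K w x\<bar> \<le> Linf_norm (D \<times> D) K * (LINT y|lebesgue_on D. \<bar>w y\<bar>)"
  using AE_integrable_kernel_mult by eventually_elim (use assms in blast)

text \<open>Additivity can be expected only almost everywhere: at points with a bad section the
  integrals may take the default value zero.\<close>

lemma AE_TK_diff:
  assumes "integrable (lebesgue_on D) v" "integrable (lebesgue_on D) w"
  shows "AE x in lebesgue_on D. TK D K v x - TK D K w x = TK D K (\<lambda>y. v y - w y) x"
  using AE_integrable_kernel_mult
  by eventually_elim (use assms in \<open>simp add: TK_def right_diff_distrib\<close>)

text \<open>Measurability of a parametric integral needs a jointly measurable integrand for the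
  uncompleted product, which the Borel representative supplies. Both operators agree almost
  everywhere, and completeness carries measurability over.\<close>

lemma borel_measurable_TK:
  assumes w: "integrable (lebesgue_on D) w"
  shows "TK D K w \<in> borel_measurable (lebesgue_on D)"
proof -
  let ?M = "lebesgue_on D"
  have lm: "D \<in> lmeasurable" using D by (auto intro: lmeasurable_open)
  then have D': "D \<in> sets lebesgue" by blast
  interpret finite_measure ?M by (rule finite_measure_lebesgue_on[OF lm])
  obtain K' where K': "K' \<in> borel_measurable borel" "\<And>z. \<bar>K' z\<bar> \<le> Linf_norm (D \<times> D) K"
    "AE x in ?M. AE y in ?M. K (x, y) = K' (x, y)"
    using Linf_kernel_representative[OF D(1) K] by blast
  have id: "(\<lambda>x. x) \<in> measurable ?M borel"
    by (simp add: measurable_restrict_space1 measurable_completion)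
  have "(\<lambda>z. (fst z, snd z)) \<in> ?M \<Otimes>\<^sub>M ?M \<rightarrow>\<^sub>M (borel \<Otimes>\<^sub>M borel :: ('a \<times> 'a) measure)"
    by (intro measurable_Pair measurable_compose[OF measurable_fst id] measurable_compose[OF measurable_snd id])
  then have "(\<lambda>z. K' (fst z, snd z)) \<in> borel_measurable (?M \<Otimes>\<^sub>M ?M)"
    using K'(1) unfolding borel_prod by (rule measurable_compose)
  then have "(\<lambda>z. K' (fst z, snd z) * w (snd z)) \<in> borel_measurable (?M \<Otimes>\<^sub>M ?M)"
    using w by (intro borel_measurable_times measurable_compose[OF measurable_snd]) auto
  then have "(\<lambda>x. LINT y|?M. K' (x, y) * w y) \<in> borel_measurable ?M"
    by (intro borel_measurable_lebesgue_integral) (simp add: case_prod_beta')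
  moreover have "AE x in ?M. (LINT y|?M. K' (x, y) * w y) = TK D K w x"
    using K'(3) AE_kernel_section
  proof eventually_elim
    case (elim x)
    have "(\<lambda>y. K' (x, y)) \<in> borel_measurable borel"
      using measurable_compose[OF _ K'(1), of "Pair x" borel] by simp
    then have "(\<lambda>y. K' (x, y)) \<in> borel_measurable ?M"
      by (simp add: measurable_restrict_space1 measurable_completion)
    then show ?case
      unfolding TK_def using elim w by (intro integral_cong_AE borel_measurable_times) auto
  qed
  ultimately show ?thesis
    by (rule borel_measurable_lebesgue_on_AE[OF D'])
qed

end

section \<open>Estimates for the individual terms of the equation against a test function\<close>

lemma integrable_AE_dominated:
  fixes g h :: "'b \<Rightarrow> real"
  assumes "g \<in> borel_measurable M" "integrable M h" "AE x in M. \<bar>g x\<bar> \<le> h x"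
  shows "integrable M g" "\<bar>integral\<^sup>L M g\<bar> \<le> integral\<^sup>L M h"
proof -
  show i: "integrable M g"
    by (rule Bochner_Integration.integrable_bound[OF assms(2,1)])
      (use assms(3) in eventually_elim, simp)
  have "\<bar>integral\<^sup>L M g\<bar> \<le> (LINT x|M. \<bar>g x\<bar>)" by (rule integral_abs_bound)
  also have "\<dots> \<le> integral\<^sup>L M h"
    by (rule integral_mono_AE[OF integrable_abs[OF i] assms(2,3)])
  finally show "\<bar>integral\<^sup>L M g\<bar> \<le> integral\<^sup>L M h" .
qed

lemma Linf_mult_bound:
  assumes a: "a \<in> Linf_space D" and b: "0 \<le> b" and c: "0 \<le> c"
    and u: "Lp_le (lebesgue_on D) 2 b u" and \<phi>: "Lp_le (lebesgue_on D) 2 c \<phi>"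
  shows "integrable (lebesgue_on D) (\<lambda>x. a x * u x * \<phi> x)"
    and "\<bar>LINT x|lebesgue_on D. a x * u x * \<phi> x\<bar> \<le> Linf_norm D a * (b * c)"
proof -
  let ?M = "lebesgue_on D"
  have a_meas: "a \<in> borel_measurable ?M" using a by (simp add: Linf_space_def)
  note CS = Cauchy_Schwarz_Lp_le[OF b c u \<phi>]
  have m: "(\<lambda>x. a x * u x * \<phi> x) \<in> borel_measurable ?M"
    by (intro borel_measurable_times a_meas Lp_leD(1)[OF u] Lp_leD(1)[OF \<phi>])
  have i: "integrable ?M (\<lambda>x. Linf_norm D a * (\<bar>u x\<bar> * \<bar>\<phi> x\<bar>))"
    by (intro integrable_mult_right CS)
  have ae: "AE x in ?M. \<bar>a x * u x * \<phi> x\<bar> \<le> Linf_norm D a * (\<bar>u x\<bar> * \<bar>\<phi> x\<bar>)"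
    using AE_Linf_norm[OF a]
    by eventually_elim (simp add: abs_mult mult.assoc mult_right_mono)
  show "integrable ?M (\<lambda>x. a x * u x * \<phi> x)"
    by (rule integrable_AE_dominated(1)[OF m i ae])
  have "\<bar>LINT x|?M. a x * u x * \<phi> x\<bar> \<le> Linf_norm D a * (LINT x|?M. \<bar>u x\<bar> * \<bar>\<phi> x\<bar>)"
    using integrable_AE_dominated(2)[OF m i ae] by simp
  also have "\<dots> \<le> Linf_norm D a * (b * c)"
    by (intro mult_left_mono CS Linf_norm_nonneg a)
  finally show "\<bar>LINT x|?M. a x * u x * \<phi> x\<bar> \<le> Linf_norm D a * (b * c)" .
qed

text \<open>Cauchy-Schwarz against the constant \<open>1\<close>. Applied to both \<open>u\<close>
  and the test function in the kernel term, the two square roots multiply to the factor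
  \<open>measure lebesgue \<Omega>\<close> in \<open>\<eta>\<close>.\<close>

lemma integral_abs_le_L2:
  assumes D: "D \<in> lmeasurable" and b: "0 \<le> b" and u: "Lp_le (lebesgue_on D) 2 b u"
  shows "integrable (lebesgue_on D) u"
    and "(LINT x|lebesgue_on D. \<bar>u x\<bar>) \<le> sqrt (measure lebesgue D) * b"
proof -
  interpret finite_measure "lebesgue_on D" by (rule finite_measure_lebesgue_on[OF D])
  have "measure (lebesgue_on D) D = measure lebesgue D"
    using D by (intro measure_restrict_space) auto
  then have "Lp_le (lebesgue_on D) 2 (sqrt (measure lebesgue D)) (\<lambda>x. 1)"
    by (simp add: Lp_le_def)
  from Cauchy_Schwarz_Lp_le[OF b _ u this]
  have *: "integrable (lebesgue_on D) (\<lambda>x. \<bar>u x\<bar>)"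
    "(LINT x|lebesgue_on D. \<bar>u x\<bar>) \<le> b * sqrt (measure lebesgue D)"
    by simp_all
  show "integrable (lebesgue_on D) u"
    using *(1) Lp_leD(1)[OF u] by (simp add: integrable_abs_iff)
  show "(LINT x|lebesgue_on D. \<bar>u x\<bar>) \<le> sqrt (measure lebesgue D) * b"
    using *(2) by (simp add: mult.commute)
qed

context
  fixes D :: "'a::euclidean_space set" and K :: "'a \<times> 'a \<Rightarrow> real"
  assumes D: "open D" "bounded D" and K: "K \<in> Linf_space (D \<times> D)"
begin

private abbreviation (input) "k \<equiv> Linf_norm (D \<times> D) K"

lemma TK_bound:
  assumes b: "0 \<le> b" and c: "0 \<le> c"
    and u: "Lp_le (lebesgue_on D) 2 b u" and \<phi>: "Lp_le (lebesgue_on D) 2 c \<phi>"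
  shows "integrable (lebesgue_on D) (\<lambda>x. TK D K u x * \<phi> x)"
    and "\<bar>LINT x|lebesgue_on D. TK D K u x * \<phi> x\<bar> \<le> measure lebesgue D * k * (b * c)"
proof -
  let ?M = "lebesgue_on D" and ?m = "measure lebesgue D"
  have lm: "D \<in> lmeasurable" using D by (intro lmeasurable_open)
  note u1 = integral_abs_le_L2[OF lm b u] and \<phi>1 = integral_abs_le_L2[OF lm c \<phi>]
  have k: "0 \<le> k" by (rule Linf_norm_nonneg[OF K])
  have m: "(\<lambda>x. TK D K u x * \<phi> x) \<in> borel_measurable ?M"
    by (intro borel_measurable_times borel_measurable_TK[OF D K u1(1)] Lp_leD(1)[OF \<phi>])
  have i: "integrable ?M (\<lambda>x. k * (sqrt ?m * b) * \<bar>\<phi> x\<bar>)"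
    by (intro integrable_mult_right integrable_abs \<phi>1)
  have ae: "AE x in ?M. \<bar>TK D K u x * \<phi> x\<bar> \<le> k * (sqrt ?m * b) * \<bar>\<phi> x\<bar>"
    using AE_abs_TK_le[OF D K u1(1)]
  proof eventually_elim
    case (elim x)
    also have "k * (LINT y|?M. \<bar>u y\<bar>) \<le> k * (sqrt ?m * b)"
      by (intro mult_left_mono u1 k)
    finally show ?case by (simp add: abs_mult mult_right_mono)
  qed
  show "integrable ?M (\<lambda>x. TK D K u x * \<phi> x)"
    by (rule integrable_AE_dominated(1)[OF m i ae])
  have "\<bar>LINT x|?M. TK D K u x * \<phi> x\<bar> \<le> k * (sqrt ?m * b) * (LINT x|?M. \<bar>\<phi> x\<bar>)"
    using integrable_AE_dominated(2)[OF m i ae] by simp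
  also have "\<dots> \<le> k * (sqrt ?m * b) * (sqrt ?m * c)"
    by (intro mult_left_mono \<phi>1 mult_nonneg_nonneg k b) simp
  also have "\<dots> = (sqrt ?m * sqrt ?m) * k * (b * c)" by (simp add: mult_ac)
  also have "sqrt ?m * sqrt ?m = ?m" by simp
  finally show "\<bar>LINT x|?M. TK D K u x * \<phi> x\<bar> \<le> ?m * k * (b * c)" .
qed

text \<open>The nonlocal factor is a linear operator applied to an integrable function, so
  measurability, bounds and differences of \<open>TK\<close> carry over to it.\<close>

lemma BQ_eq_TK: "BQ D K q u = TK D K (\<lambda>y. \<bar>u y\<bar> powr q)"
  by (simp add: fun_eq_iff BQ_def TK_def)

lemma AE_BQ_le:
  assumes "Lp_le (lebesgue_on D) q b u"
  shows "AE x in lebesgue_on D. \<bar>BQ D K q u x\<bar> \<le> k * b powr q"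
  unfolding BQ_eq_TK using AE_abs_TK_le[OF D K Lp_leD(2)[OF assms]]
proof eventually_elim
  case (elim x)
  also have "k * (LINT y|lebesgue_on D. \<bar>\<bar>u y\<bar> powr q\<bar>) \<le> k * b powr q"
    using Lp_leD(3)[OF assms] by (intro mult_left_mono Linf_norm_nonneg K) simp
  finally show ?case .
qed

lemma borel_measurable_NQ:
  assumes "Lp_le (lebesgue_on D) q b u"
  shows "NQ D K q u \<in> borel_measurable (lebesgue_on D)"
proof -
  note [measurable] = borel_measurable_TK[OF D K Lp_leD(2)[OF assms]] Lp_leD(1)[OF assms]
  show ?thesis unfolding NQ_def[abs_def] BQ_eq_TK by measurable
qed

text \<open>\<open>BQ\<close> is at most \<open>k * b powr q\<close>, and Hoelder's inequality
  yields \<open>b powr (q - 1) * c\<close> for the rest. The power \<open>2 * q - 1\<close> of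
  \<open>b\<close> is regrouped to expose the exponent \<open>2 * q - 2\<close> of the smallness
  conditions.\<close>

lemma NQ_bound:
  assumes q: "2 \<le> q" and b: "0 < b" and c: "0 \<le> c"
    and u: "Lp_le (lebesgue_on D) q b u" and \<phi>: "Lp_le (lebesgue_on D) q c \<phi>"
  shows "integrable (lebesgue_on D) (\<lambda>x. NQ D K q u x * \<phi> x)"
    and "\<bar>LINT x|lebesgue_on D. NQ D K q u x * \<phi> x\<bar> \<le> k * b powr (2 * q - 2) * (b * c)"
proof -
  let ?M = "lebesgue_on D"
  have k: "0 \<le> k" by (rule Linf_norm_nonneg[OF K])
  note H = Holder_powr[OF q b c u \<phi>]
  have m: "(\<lambda>x. NQ D K q u x * \<phi> x) \<in> borel_measurable ?M"
    by (intro borel_measurable_times borel_measurable_NQ[OF u] Lp_leD(1)[OF \<phi>])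
  have i: "integrable ?M (\<lambda>x. k * b powr q * (\<bar>u x\<bar> powr (q - 1) * \<bar>\<phi> x\<bar>))"
    by (intro integrable_mult_right H)
  have e: "\<bar>t\<bar> powr (q - 2) * \<bar>t\<bar> = \<bar>t\<bar> powr (q - 1)" for t
    using abs_powr_mult_abs[of "q - 1" t] q by simp
  have ae: "AE x in ?M. \<bar>NQ D K q u x * \<phi> x\<bar> \<le> k * b powr q * (\<bar>u x\<bar> powr (q - 1) * \<bar>\<phi> x\<bar>)"
    using AE_BQ_le[OF u]
  proof eventually_elim
    case (elim x)
    have "\<bar>NQ D K q u x * \<phi> x\<bar> = \<bar>BQ D K q u x\<bar> * ((\<bar>u x\<bar> powr (q - 2) * \<bar>u x\<bar>) * \<bar>\<phi> x\<bar>)"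
      by (simp add: NQ_def abs_mult)
    also have "\<dots> \<le> k * b powr q * (\<bar>u x\<bar> powr (q - 1) * \<bar>\<phi> x\<bar>)"
      unfolding e by (intro mult_right_mono elim) simp
    finally show ?case .
  qed
  show "integrable ?M (\<lambda>x. NQ D K q u x * \<phi> x)"
    by (rule integrable_AE_dominated(1)[OF m i ae])
  have "\<bar>LINT x|?M. NQ D K q u x * \<phi> x\<bar> \<le> k * b powr q * (LINT x|?M. \<bar>u x\<bar> powr (q - 1) * \<bar>\<phi> x\<bar>)"
    using integrable_AE_dominated(2)[OF m i ae] by simp
  also have "\<dots> \<le> k * b powr q * (b powr (q - 1) * c)"
    by (intro mult_left_mono H mult_nonneg_nonneg k) simp
  also have "b powr q * b powr (q - 1) = b powr (2 * q - 2) * b"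
    using b powr_mult_base[of b "2 * q - 2"] by (simp add: mult.commute flip: powr_add)
  then have "k * b powr q * (b powr (q - 1) * c) = k * b powr (2 * q - 2) * (b * c)"
    by (simp add: mult.assoc)
  finally show "\<bar>LINT x|?M. NQ D K q u x * \<phi> x\<bar> \<le> k * b powr (2 * q - 2) * (b * c)" .
qed

text \<open>A discrete product rule: the signed power and \<open>BQ\<close> are varied one after the
  other. In the first part Hoelder's inequality gives \<open>(2 * b) powr (q - 2)\<close>; in the
  second, varying \<open>BQ\<close> gives \<open>(2 * b) powr (q - 1)\<close>. Both leave the same
  power of \<open>b\<close>, so the coefficients add up.\<close>

lemma NQ_diff_bound:
  assumes q: "2 \<le> q" and b: "0 < b" and c: "0 \<le> c" and d: "0 \<le> d"
    and u: "Lp_le (lebesgue_on D) q b u" and v: "Lp_le (lebesgue_on D) q b v"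
    and w: "Lp_le (lebesgue_on D) q d (\<lambda>x. u x - v x)" and \<phi>: "Lp_le (lebesgue_on D) q c \<phi>"
  shows "\<bar>LINT x|lebesgue_on D. (NQ D K q u x - NQ D K q v x) * \<phi> x\<bar>
    \<le> k * ((q - 1) * 2 powr (q - 2) + q * 2 powr (q - 1)) * b powr (2 * q - 2) * (d * c)"
proof -
  let ?M = "lebesgue_on D"
  have k: "0 \<le> k" by (rule Linf_norm_nonneg[OF K])
  have q1: "1 \<le> q" using q by simp
  have A: "Lp_le ?M q (2 * b) (\<lambda>x. \<bar>u x\<bar> + \<bar>v x\<bar>)"
    by (rule Lp_le_abs_add[OF q1 u v]) (use b in simp)
  have b2: "0 < 2 * b" using b by simp
  note H1 = Holder_three[OF q b2 d c A w \<phi>]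
  note H2 = Holder_powr[OF q b2 d A w]
  note H3 = Holder_powr[OF q b c v \<phi>]
  \<comment> \<open>A bound for \<open>\<bar>BQ D K q u x - BQ D K q v x\<bar>\<close> that no
    longer depends on \<open>x\<close>.\<close>
  define \<beta> where "\<beta> = k * (q * ((2 * b) powr (q - 1) * d))"
  have \<beta>: "0 \<le> \<beta>" unfolding \<beta>_def using k q d by (intro mult_nonneg_nonneg) auto
  have pu: "integrable ?M (\<lambda>y. \<bar>u y\<bar> powr q)" and pv: "integrable ?M (\<lambda>y. \<bar>v y\<bar> powr q)"
    using Lp_leD(2) u v by blast+
  have "(LINT y|?M. \<bar>\<bar>u y\<bar> powr q - \<bar>v y\<bar> powr q\<bar>)
      \<le> (LINT y|?M. q * (\<bar>\<bar>u y\<bar> + \<bar>v y\<bar>\<bar> powr (q - 1) * \<bar>u y - v y\<bar>))"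
  proof (rule integral_mono)
    show "\<bar>\<bar>u y\<bar> powr q - \<bar>v y\<bar> powr q\<bar> \<le> q * (\<bar>\<bar>u y\<bar> + \<bar>v y\<bar>\<bar> powr (q - 1) * \<bar>u y - v y\<bar>)" for y
      using abs_powr_diff_le[OF q1, of "u y" "v y"] by (simp add: mult.assoc)
  qed (intro integrable_abs Bochner_Integration.integrable_diff pu pv integrable_mult_right H2)+
  also have "\<dots> \<le> q * ((2 * b) powr (q - 1) * d)"
    using H2(2) q by simp
  finally have diff_int: "(LINT y|?M. \<bar>\<bar>u y\<bar> powr q - \<bar>v y\<bar> powr q\<bar>) \<le> q * ((2 * b) powr (q - 1) * d)" .
  have BQ_diff: "AE x in ?M. \<bar>BQ D K q u x - BQ D K q v x\<bar> \<le> \<beta>"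
    unfolding BQ_eq_TK
    using AE_TK_diff[OF D K pu pv] AE_abs_TK_le[OF D K Bochner_Integration.integrable_diff[OF pu pv]]
  proof eventually_elim
    case (elim x)
    have "k * (LINT y|?M. \<bar>\<bar>u y\<bar> powr q - \<bar>v y\<bar> powr q\<bar>) \<le> \<beta>"
      unfolding \<beta>_def by (intro mult_left_mono diff_int k)
    with elim show ?case by simp
  qed
  define h where "h = (\<lambda>x. k * b powr q * (q - 1) * (\<bar>\<bar>u x\<bar> + \<bar>v x\<bar>\<bar> powr (q - 2) * (\<bar>u x - v x\<bar> * \<bar>\<phi> x\<bar>))
      + \<beta> * (\<bar>v x\<bar> powr (q - 1) * \<bar>\<phi> x\<bar>))"
  have m: "(\<lambda>x. (NQ D K q u x - NQ D K q v x) * \<phi> x) \<in> borel_measurable ?M"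
    by (intro borel_measurable_times borel_measurable_diff borel_measurable_NQ[OF u]
      borel_measurable_NQ[OF v] Lp_leD(1)[OF \<phi>])
  have i: "integrable ?M h"
    unfolding h_def by (intro Bochner_Integration.integrable_add integrable_mult_right H1 H3)
  have e: "\<bar>t\<bar> powr (q - 2) * \<bar>t\<bar> = \<bar>t\<bar> powr (q - 1)" for t
    using abs_powr_mult_abs[of "q - 1" t] q by simp
  have ae: "AE x in ?M. \<bar>(NQ D K q u x - NQ D K q v x) * \<phi> x\<bar> \<le> h x"
    using AE_BQ_le[OF u] BQ_diff
  proof eventually_elim
    case (elim x)
    let ?s = "\<lambda>t::real. \<bar>t\<bar> powr (q - 2) * t"
    have "NQ D K q u x - NQ D K q v x
        = (?s (u x) - ?s (v x)) * BQ D K q u x + ?s (v x) * (BQ D K q u x - BQ D K q v x)"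
      by (simp add: NQ_def algebra_simps)
    then have "\<bar>NQ D K q u x - NQ D K q v x\<bar>
        \<le> \<bar>?s (u x) - ?s (v x)\<bar> * \<bar>BQ D K q u x\<bar> + \<bar>?s (v x)\<bar> * \<bar>BQ D K q u x - BQ D K q v x\<bar>"
      by (metis abs_mult abs_triangle_ineq)
    also have "\<dots> \<le> ((q - 1) * (\<bar>u x\<bar> + \<bar>v x\<bar>) powr (q - 2) * \<bar>u x - v x\<bar>) * (k * b powr q)
        + \<bar>v x\<bar> powr (q - 1) * \<beta>"
    proof (rule add_mono)
      show "\<bar>?s (u x) - ?s (v x)\<bar> * \<bar>BQ D K q u x\<bar>
        \<le> ((q - 1) * (\<bar>u x\<bar> + \<bar>v x\<bar>) powr (q - 2) * \<bar>u x - v x\<bar>) * (k * b powr q)"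
        using q by (intro mult_mono signed_powr_diff_le elim mult_nonneg_nonneg) simp_all
      have "\<bar>?s (v x)\<bar> = \<bar>v x\<bar> powr (q - 1)"
        unfolding abs_mult by (simp add: e)
      then show "\<bar>?s (v x)\<bar> * \<bar>BQ D K q u x - BQ D K q v x\<bar> \<le> \<bar>v x\<bar> powr (q - 1) * \<beta>"
        using elim(2) by (simp add: mult_left_mono)
    qed
    finally have "\<bar>NQ D K q u x - NQ D K q v x\<bar> * \<bar>\<phi> x\<bar>
      \<le> (((q - 1) * (\<bar>u x\<bar> + \<bar>v x\<bar>) powr (q - 2) * \<bar>u x - v x\<bar>) * (k * b powr q)
        + \<bar>v x\<bar> powr (q - 1) * \<beta>) * \<bar>\<phi> x\<bar>"
      by (rule mult_right_mono) simp
    also have "\<dots> = h x"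
      unfolding h_def by (simp add: algebra_simps)
    finally show ?case by (simp add: abs_mult)
  qed
  have "\<bar>LINT x|?M. (NQ D K q u x - NQ D K q v x) * \<phi> x\<bar> \<le> integral\<^sup>L ?M h"
    by (rule integrable_AE_dominated(2)[OF m i ae])
  also have "\<dots> = k * b powr q * (q - 1) * (LINT x|?M. \<bar>\<bar>u x\<bar> + \<bar>v x\<bar>\<bar> powr (q - 2) * (\<bar>u x - v x\<bar> * \<bar>\<phi> x\<bar>))
      + \<beta> * (LINT x|?M. \<bar>v x\<bar> powr (q - 1) * \<bar>\<phi> x\<bar>)"
    unfolding h_def using H1(1) H3(1)
    by (subst Bochner_Integration.integral_add) (simp_all only: integrable_mult_right integral_mult_right_zero)
  also have "\<dots> \<le> k * b powr q * (q - 1) * ((2 * b) powr (q - 2) * (d * c)) + \<beta> * (b powr (q - 1) * c)"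
    using k q \<beta> by (intro add_mono mult_left_mono H1 H3 mult_nonneg_nonneg) simp_all
  also have "\<dots> = k * (q - 1) * (b powr q * (2 * b) powr (q - 2)) * (d * c)
      + k * q * ((2 * b) powr (q - 1) * b powr (q - 1)) * (d * c)"
    by (simp add: \<beta>_def mult_ac)
  also have "b powr q * (2 * b) powr (q - 2) = 2 powr (q - 2) * b powr (2 * q - 2)"
    using b by (simp add: powr_mult mult.left_commute[of "b powr q"] flip: powr_add)
  also have "(2 * b) powr (q - 1) * b powr (q - 1) = 2 powr (q - 1) * b powr (2 * q - 2)"
    using b by (simp add: powr_mult mult.assoc flip: powr_add)
  also have "k * (q - 1) * (2 powr (q - 2) * b powr (2 * q - 2)) * (d * c)
      + k * q * (2 powr (q - 1) * b powr (2 * q - 2)) * (d * c)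
    = k * ((q - 1) * 2 powr (q - 2) + q * 2 powr (q - 1)) * b powr (2 * q - 2) * (d * c)"
    by (simp add: distrib_left distrib_right mult_ac)
  finally show ?thesis .
qed

end

section \<open>Complete symmetric forms\<close>

lemma quadratic_nonneg_imp:
  fixes b c e :: real
  assumes "\<And>t. 0 \<le> e + 2 * t * b + t\<^sup>2 * c" "0 \<le> c" "0 \<le> e"
  shows "b\<^sup>2 \<le> e * c"
proof (cases "c = 0")
  case True
  show ?thesis
  proof (cases "b = 0")
    case False
    \<comment> \<open>At this \<open>t\<close> the affine function equals \<open>-1\<close>, so a
      nonzero slope is impossible.\<close>
    have "0 \<le> e + 2 * (- (e + 1) / (2 * b)) * b"
      using assms(1)[of "- (e + 1) / (2 * b)"] True by simp
    then show ?thesis using False by (simp add: field_simps)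
  qed (use assms in simp)
next
  case False
  then have c: "c > 0" using assms by simp
  \<comment> \<open>The minimizer of the parabola.\<close>
  have "0 \<le> e + 2 * (- b / c) * b + (- b / c)\<^sup>2 * c" by (rule assms)
  also have "\<dots> = e - b\<^sup>2 / c"
    using c by (simp add: field_simps power2_eq_square)
  finally show ?thesis using c by (simp add: field_simps)
qed

text \<open>
  The form vanishes on functions that are zero almost everywhere, so that elements are determined
  only up to \<open>nrm (\<lambda>x. u x - v x) = 0\<close>.
\<close>

locale semi_inner_form =
  fixes V :: "('a \<Rightarrow> real) set" and E :: "('a \<Rightarrow> real) \<Rightarrow> ('a \<Rightarrow> real) \<Rightarrow> real"
  assumes zero_mem: "(\<lambda>x. 0) \<in> V"
    and lin_mem: "u \<in> V \<Longrightarrow> v \<in> V \<Longrightarrow> (\<lambda>x. u x + c * v x) \<in> V"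
    and E_sym: "u \<in> V \<Longrightarrow> v \<in> V \<Longrightarrow> E u v = E v u"
    and E_lin: "u \<in> V \<Longrightarrow> v \<in> V \<Longrightarrow> w \<in> V \<Longrightarrow> E (\<lambda>x. u x + c * v x) w = E u w + c * E v w"
    and E_nonneg: "u \<in> V \<Longrightarrow> 0 \<le> E u u"
begin

definition nrm :: "('a \<Rightarrow> real) \<Rightarrow> real" where "nrm u = sqrt (E u u)"

lemma diff_mem: "u \<in> V \<Longrightarrow> v \<in> V \<Longrightarrow> (\<lambda>x. u x - v x) \<in> V"
  using lin_mem[of u v "-1"] by simp

lemma scale_mem: "v \<in> V \<Longrightarrow> (\<lambda>x. c * v x) \<in> V"
  using lin_mem[OF zero_mem, of v c] by simp

lemma E_lin_right:
  "u \<in> V \<Longrightarrow> v \<in> V \<Longrightarrow> w \<in> V \<Longrightarrow> E w (\<lambda>x. u x + c * v x) = E w u + c * E w v"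
  using E_lin[of u v w c] E_sym lin_mem by metis

lemma E_diff: "u \<in> V \<Longrightarrow> v \<in> V \<Longrightarrow> w \<in> V \<Longrightarrow> E (\<lambda>x. u x - v x) w = E u w - E v w"
  using E_lin[of u v w "-1"] by simp

lemma nrm_nonneg: "u \<in> V \<Longrightarrow> 0 \<le> nrm u"
  by (simp add: nrm_def E_nonneg)

lemma nrm_square: "u \<in> V \<Longrightarrow> (nrm u)\<^sup>2 = E u u"
  by (simp add: nrm_def E_nonneg)

lemma nrm_scale:
  assumes "u \<in> V"
  shows "nrm (\<lambda>x. c * u x) = \<bar>c\<bar> * nrm u"
proof -
  have z: "E (\<lambda>x. 0) w = 0" if "w \<in> V" for w
    using E_lin[OF zero_mem zero_mem that, of 1] by simp
  have "E (\<lambda>x. c * u x) (\<lambda>x. c * u x) = c * E u (\<lambda>x. c * u x)"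
    using E_lin[OF zero_mem assms scale_mem[OF assms], of c c] z[OF scale_mem[OF assms]] by simp
  also have "E u (\<lambda>x. c * u x) = c * E u u"
    using E_lin_right[OF zero_mem assms assms, of c] z[OF assms] E_sym[OF zero_mem assms] by simp
  finally have "E (\<lambda>x. c * u x) (\<lambda>x. c * u x) = c\<^sup>2 * E u u"
    by (simp add: power2_eq_square)
  then show ?thesis by (simp add: nrm_def real_sqrt_mult)
qed

lemma E_expand:
  assumes "u \<in> V" "v \<in> V"
  shows "E (\<lambda>x. u x + c * v x) (\<lambda>x. u x + c * v x) = E u u + 2 * c * E u v + c\<^sup>2 * E v v"
  using assms E_sym[of u v]
  by (simp add: E_lin E_lin_right lin_mem power2_eq_square algebra_simps)

lemma Cauchy_Schwarz:
  assumes "u \<in> V" "v \<in> V"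
  shows "\<bar>E u v\<bar> \<le> nrm u * nrm v"
proof -
  have "(E u v)\<^sup>2 \<le> E u u * E v v"
  proof (rule quadratic_nonneg_imp)
    show "0 \<le> E u u + 2 * t * E u v + t\<^sup>2 * E v v" for t
      using E_nonneg[OF lin_mem[OF assms, of t]] E_expand[OF assms, of t] by simp
  qed (use assms E_nonneg in auto)
  then have "sqrt ((E u v)\<^sup>2) \<le> sqrt (E u u * E v v)"
    by (rule real_sqrt_le_mono)
  then show ?thesis by (simp add: nrm_def real_sqrt_mult)
qed

lemma nrm_add_le:
  assumes "u \<in> V" "v \<in> V"
  shows "nrm (\<lambda>x. u x + v x) \<le> nrm u + nrm v"
proof (rule power2_le_imp_le)
  have "(\<lambda>x. u x + v x) \<in> V" using lin_mem[OF assms, of 1] by simp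
  then have "(nrm (\<lambda>x. u x + v x))\<^sup>2 = (nrm u)\<^sup>2 + 2 * E u v + (nrm v)\<^sup>2"
    using E_expand[OF assms, of 1] assms by (simp add: nrm_square)
  also have "\<dots> \<le> (nrm u + nrm v)\<^sup>2"
    using Cauchy_Schwarz[OF assms] by (simp add: power2_sum abs_le_iff)
  finally show "(nrm (\<lambda>x. u x + v x))\<^sup>2 \<le> (nrm u + nrm v)\<^sup>2" .
qed (use assms nrm_nonneg in auto)

lemma nrm_triangle:
  assumes "u \<in> V" "v \<in> V" "w \<in> V"
  shows "nrm (\<lambda>x. u x - w x) \<le> nrm (\<lambda>x. u x - v x) + nrm (\<lambda>x. v x - w x)"
  using nrm_add_le[OF diff_mem[OF assms(1,2)] diff_mem[OF assms(2,3)]] by simp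

lemma nrm_minus_commute:
  assumes "u \<in> V" "v \<in> V"
  shows "nrm (\<lambda>x. u x - v x) = nrm (\<lambda>x. v x - u x)"
  using nrm_scale[OF diff_mem[OF assms(2,1)], of "-1"] by simp

lemma nrm_le_diff:
  assumes "u \<in> V" "v \<in> V"
  shows "nrm u \<le> nrm v + nrm (\<lambda>x. u x - v x)"
  using nrm_add_le[OF assms(2) diff_mem[OF assms]] by simp

lemma E_tendsto:
  assumes "\<And>n. u n \<in> V" "v \<in> V" "w \<in> V" and lim: "(\<lambda>n. nrm (\<lambda>x. u n x - v x)) \<longlonglongrightarrow> 0"
  shows "(\<lambda>n. E (u n) w) \<longlonglongrightarrow> E v w"
proof -
  have "(\<lambda>n. E (u n) w - E v w) \<longlonglongrightarrow> 0"
  proof (rule Lim_null_comparison)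
    show "eventually (\<lambda>n. norm (E (u n) w - E v w) \<le> nrm (\<lambda>x. u n x - v x) * nrm w) sequentially"
      using Cauchy_Schwarz[OF diff_mem[OF assms(1,2)] assms(3)] assms
      by (simp add: E_diff[symmetric])
    show "(\<lambda>n. nrm (\<lambda>x. u n x - v x) * nrm w) \<longlonglongrightarrow> 0"
      using tendsto_mult_right[OF lim, of "nrm w"] by simp
  qed
  then show ?thesis by (simp add: LIM_zero_iff)
qed

end

text \<open>
  Completeness is only required for sequences with summable increments, which avoids passing to
  subsequences.
\<close>

locale complete_form = semi_inner_form +
  assumes E_complete: "(\<And>n. us n \<in> V) \<Longrightarrow>
      summable (\<lambda>n. sqrt (E (\<lambda>x. us (Suc n) x - us n x) (\<lambda>x. us (Suc n) x - us n x))) \<Longrightarrow>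
      \<exists>v\<in>V. (\<lambda>n. sqrt (E (\<lambda>x. us n x - v x) (\<lambda>x. us n x - v x))) \<longlonglongrightarrow> 0"
begin

lemma nrm_complete:
  assumes "\<And>n. u n \<in> V" "summable (\<lambda>n. nrm (\<lambda>x. u (Suc n) x - u n x))"
  shows "\<exists>v\<in>V. (\<lambda>n. nrm (\<lambda>x. u n x - v x)) \<longlonglongrightarrow> 0"
  using E_complete[OF assms(1)] assms(2) by (simp add: nrm_def)

text \<open>
  A minimizing sequence of \<open>E u u - 2 * l u\<close> has summable increments by the parallelogram law.
\<close>

lemma Riesz_representation:
  assumes l_lin: "\<And>u v c. u \<in> V \<Longrightarrow> v \<in> V \<Longrightarrow> l (\<lambda>x. u x + c * v x) = l u + c * l v"
    and l_bound: "\<And>u. u \<in> V \<Longrightarrow> \<bar>l u\<bar> \<le> C * nrm u"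
  shows "\<exists>w\<in>V. \<forall>\<phi>\<in>V. E w \<phi> = l \<phi>"
proof -
  define J where "J = (\<lambda>u. E u u - 2 * l u)"
  define m where "m = Inf (J ` V)"
  \<comment> \<open>Completing the square in \<open>nrm u\<close> bounds the functional from
    below.\<close>
  have J_lower: "- C\<^sup>2 \<le> J u" if "u \<in> V" for u
  proof -
    have "0 \<le> (nrm u - C)\<^sup>2" by simp
    also have "\<dots> = E u u - 2 * (C * nrm u) + C\<^sup>2"
      using nrm_square[OF that] by (simp add: power2_diff)
    finally show ?thesis
      using l_bound[OF that] unfolding J_def by linarith
  qed
  then have bdd: "bdd_below (J ` V)" by (auto intro!: bdd_belowI2)
  have m_le: "m \<le> J u" if "u \<in> V" for u
    unfolding m_def using bdd that by (intro cInf_lower) auto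
  \<comment> \<open>The distances are controlled by square roots of the excess over
    \<open>m\<close>, so the rate \<open>1/4\<close> yields increments of order
    \<open>(1/2) ^ n\<close>, which are summable.\<close>
  have "\<exists>u\<in>V. J u < m + (1/4) ^ n" for n :: nat
  proof -
    have "\<exists>y\<in>J ` V. y < m + (1/4) ^ n"
      using zero_mem unfolding m_def by (intro cInf_lessD) auto
    then show ?thesis by blast
  qed
  then obtain u where u: "\<And>n. u n \<in> V" "\<And>n. J (u n) < m + (1/4) ^ n"
    by metis
  have J_expand: "J (\<lambda>x. w x + t * \<phi> x) = J w + 2 * t * (E w \<phi> - l \<phi>) + t\<^sup>2 * E \<phi> \<phi>"
    if "w \<in> V" "\<phi> \<in> V" for w \<phi> t
    using that by (simp add: J_def E_expand l_lin algebra_simps)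
  have step: "nrm (\<lambda>x. u (Suc n) x - u n x) \<le> 2 * (1/2) ^ n" for n
  proof (rule power2_le_imp_le)
    let ?d = "\<lambda>x. u (Suc n) x - u n x"
    have d: "?d \<in> V" using u by (intro diff_mem)
    have 1: "J (u (Suc n)) = J (u n) + 2 * (E (u n) ?d - l ?d) + E ?d ?d"
      using J_expand[OF u(1)[of n] d, of 1] by simp
    \<comment> \<open>This compares \<open>m\<close> with the value at the midpoint of two
      consecutive terms. Eliminating the first-order term between \<open>1\<close> and
      \<open>2\<close> leaves a bound for \<open>E ?d ?d\<close>.\<close>
    have 2: "m \<le> J (u n) + (E (u n) ?d - l ?d) + E ?d ?d / 4"
      using J_expand[OF u(1)[of n] d, of "1/2"] m_le[OF lin_mem[OF u(1)[of n] d, of "1/2"]]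
      by (simp add: power2_eq_square)
    have "E ?d ?d \<le> 2 * (J (u n) - m) + 2 * (J (u (Suc n)) - m)"
      using 1 2 by simp
    also have "\<dots> \<le> 4 * (1/4) ^ n"
    proof -
      have "(1/4) ^ Suc n \<le> (1/4 :: real) ^ n" by simp
      moreover have "2 * (x - m) + 2 * (y - m) \<le> 4 * a" if "x < m + a" "y < m + b" "b \<le> a"
        for x y a b :: real
        using that by (simp add: algebra_simps)
      ultimately show ?thesis using u(2)[of n] u(2)[of "Suc n"] by blast
    qed
    also have "\<dots> = (2 * (1/2) ^ n)\<^sup>2"
    proof -
      have "(1/4 :: real) ^ n = ((1/2) * (1/2)) ^ n" by simp
      then show ?thesis unfolding power_mult_distrib by (simp add: power2_eq_square)
    qed
    finally show "(nrm ?d)\<^sup>2 \<le> (2 * (1/2) ^ n)\<^sup>2"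
      using nrm_square[OF d] by simp
  qed simp
  have "summable (\<lambda>n. nrm (\<lambda>x. u (Suc n) x - u n x))"
  proof (rule summable_comparison_test')
    show "summable (\<lambda>n. 2 * (1/2::real) ^ n)" by (intro summable_mult summable_geometric) simp
    show "norm (nrm (\<lambda>x. u (Suc n) x - u n x)) \<le> 2 * (1/2) ^ n" if "0 \<le> n" for n
      using step[of n] nrm_nonneg[OF diff_mem[OF u(1)[of "Suc n"] u(1)[of n]]] by simp
  qed
  then obtain w where w: "w \<in> V" "(\<lambda>n. nrm (\<lambda>x. u n x - w x)) \<longlonglongrightarrow> 0"
    using nrm_complete[of u] u(1) by blast
  have "E w \<phi> = l \<phi>" if \<phi>: "\<phi> \<in> V" for \<phi>
  proof -
    \<comment> \<open>Near-minimality of \<open>u n\<close> is passed to the limit in this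
      expansion, so \<open>J w = m\<close> need not be shown. Its constant term vanishes in the
      limit, and the discriminant bound then forces the linear coefficient to be zero.\<close>
    have "0 \<le> 0 + 2 * t * (E w \<phi> - l \<phi>) + t\<^sup>2 * E \<phi> \<phi>" for t
    proof (rule tendsto_lowerbound)
      show "(\<lambda>n. (1/4) ^ n + 2 * t * (E (u n) \<phi> - l \<phi>) + t\<^sup>2 * E \<phi> \<phi>)
        \<longlonglongrightarrow> 0 + 2 * t * (E w \<phi> - l \<phi>) + t\<^sup>2 * E \<phi> \<phi>"
        by (intro tendsto_intros E_tendsto u w \<phi>) auto
      have "0 \<le> (1/4) ^ n + 2 * t * (E (u n) \<phi> - l \<phi>) + t\<^sup>2 * E \<phi> \<phi>" for n
        using m_le[OF lin_mem[OF u(1)[of n] \<phi>, of t]] J_expand[OF u(1)[of n] \<phi>, of t] u(2)[of n]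
        by linarith
      then show "eventually (\<lambda>n. 0 \<le> (1/4) ^ n + 2 * t * (E (u n) \<phi> - l \<phi>) + t\<^sup>2 * E \<phi> \<phi>) sequentially"
        by simp
    qed simp
    then have "(E w \<phi> - l \<phi>)\<^sup>2 \<le> 0 * E \<phi> \<phi>"
      by (intro quadratic_nonneg_imp) (use E_nonneg \<phi> in auto)
    then show ?thesis by simp
  qed
  with w(1) show ?thesis by blast
qed

text \<open>\<open>S\<close> is a relation because values are determined only up to norm zero:
  taking \<open>v = u\<close> in \<open>contr\<close> shows that any two values of \<open>u\<close>
  have distance zero. The fixed point is constructed from one auxiliary sequence, and every sequence
  following \<open>S\<close> inside the ball is then compared with that fixed point
  directly.\<close>

lemma contraction_iteration:
  fixes S :: "('a \<Rightarrow> real) \<Rightarrow> ('a \<Rightarrow> real) \<Rightarrow> bool"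
  defines "B \<equiv> \<lambda>r. {u \<in> V. nrm u \<le> r}"
  assumes r: "0 \<le> r" and k: "0 \<le> k" "k < 1"
    and ex: "\<And>u. u \<in> B r \<Longrightarrow> \<exists>w. S u w"
    and self: "\<And>u w. u \<in> B r \<Longrightarrow> S u w \<Longrightarrow> w \<in> B r"
    and contr: "\<And>u v w z. u \<in> B r \<Longrightarrow> v \<in> B r \<Longrightarrow> S u w \<Longrightarrow> S v z \<Longrightarrow>
      nrm (\<lambda>x. w x - z x) \<le> k * nrm (\<lambda>x. u x - v x)"
    and cong: "\<And>u w z. u \<in> B r \<Longrightarrow> S u w \<Longrightarrow> z \<in> V \<Longrightarrow> nrm (\<lambda>x. w x - z x) = 0 \<Longrightarrow> S u z"
  shows "\<exists>v\<in>B r. S v v \<and>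
    (\<forall>w\<in>B r. S w w \<longrightarrow> nrm (\<lambda>x. w x - v x) = 0) \<and>
    (\<forall>u n. u 0 \<in> B r \<longrightarrow> (\<forall>n. u n \<in> B r \<longrightarrow> S (u n) (u (Suc n))) \<longrightarrow>
      u n \<in> B r \<and> nrm (\<lambda>x. u n x - v x) \<le> k ^ n * nrm (\<lambda>x. u 0 x - v x))"
proof -
  have BV: "u \<in> V" if "u \<in> B r" for u using that by (simp add: B_def)
  obtain T where T: "\<And>u. u \<in> B r \<Longrightarrow> S u (T u)" using ex by metis
  define u where "u = rec_nat (\<lambda>x. 0) (\<lambda>n. T)"
  have uS: "u (Suc n) = T (u n)" for n by (simp add: u_def)
  have uB: "u n \<in> B r" for n
  proof (induction n)
    case 0
    have "nrm (\<lambda>x. 0) = 0" using nrm_scale[OF zero_mem, of 0] by simp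
    then show ?case using zero_mem r by (simp add: u_def B_def)
  next
    case (Suc n)
    then show ?case using self[OF Suc T[OF Suc]] by (simp add: uS)
  qed
  have S: "S (u n) (u (Suc n))" for n using T[OF uB[of n]] by (simp add: uS)
  let ?c = "nrm (\<lambda>x. u (Suc 0) x - u 0 x)"
  have step: "nrm (\<lambda>x. u (Suc n) x - u n x) \<le> k ^ n * ?c" for n
  proof (induction n)
    case (Suc n)
    have "nrm (\<lambda>x. u (Suc (Suc n)) x - u (Suc n) x) \<le> k * nrm (\<lambda>x. u (Suc n) x - u n x)"
      by (intro contr uB S)
    also have "\<dots> \<le> k * (k ^ n * ?c)" by (intro mult_left_mono Suc k)
    finally show ?case by (simp add: mult_ac)
  qed simp
  have "summable (\<lambda>n. nrm (\<lambda>x. u (Suc n) x - u n x))"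
  proof (rule summable_comparison_test')
    show "summable (\<lambda>n. k ^ n * ?c)" using k by (intro summable_mult2 summable_geometric) simp
    show "norm (nrm (\<lambda>x. u (Suc n) x - u n x)) \<le> k ^ n * ?c" if "0 \<le> n" for n
      using step[of n] nrm_nonneg[OF diff_mem[OF BV[OF uB[of "Suc n"]] BV[OF uB[of n]]]] by simp
  qed
  then obtain v where v: "v \<in> V" "(\<lambda>n. nrm (\<lambda>x. u n x - v x)) \<longlonglongrightarrow> 0"
    using nrm_complete[of u] BV[OF uB] by blast
  have vB: "v \<in> B r"
  proof -
    have "nrm v \<le> r + 0"
    proof (rule tendsto_lowerbound)
      show "(\<lambda>n. r + nrm (\<lambda>x. u n x - v x)) \<longlonglongrightarrow> r + 0" by (intro tendsto_intros v)
      have "nrm v \<le> r + nrm (\<lambda>x. u n x - v x)" for n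
        using nrm_le_diff[OF v(1) BV[OF uB[of n]]] nrm_minus_commute[OF v(1) BV[OF uB[of n]]] uB[of n]
        by (simp add: B_def)
      then show "eventually (\<lambda>n. nrm v \<le> r + nrm (\<lambda>x. u n x - v x)) sequentially" by simp
    qed simp
    then show ?thesis using v by (simp add: B_def)
  qed
  obtain z where z: "S v z" using ex[OF vB] by blast
  have zV: "z \<in> V" using self[OF vB z] by (rule BV)
  \<comment> \<open>A value \<open>z\<close> of \<open>v\<close> is compared with \<open>v\<close>
    through \<open>u (Suc n)\<close>. Only distance zero results, and \<open>cong\<close> turns it
    into \<open>S v v\<close>.\<close>
  have "nrm (\<lambda>x. z x - v x) \<le> k * 0 + 0"
  proof (rule tendsto_lowerbound)
    show "(\<lambda>n. k * nrm (\<lambda>x. u n x - v x) + nrm (\<lambda>x. u (Suc n) x - v x)) \<longlonglongrightarrow> k * 0 + 0"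
      by (intro tendsto_intros v LIMSEQ_Suc)
    have "nrm (\<lambda>x. z x - v x) \<le> k * nrm (\<lambda>x. u n x - v x) + nrm (\<lambda>x. u (Suc n) x - v x)" for n
      using nrm_triangle[OF zV BV[OF uB[of "Suc n"]] v(1)] contr[OF uB[of n] vB S z]
        nrm_minus_commute[OF zV BV[OF uB[of "Suc n"]]] by simp
    then show "eventually (\<lambda>n. nrm (\<lambda>x. z x - v x)
      \<le> k * nrm (\<lambda>x. u n x - v x) + nrm (\<lambda>x. u (Suc n) x - v x)) sequentially" by simp
  qed simp
  then have "nrm (\<lambda>x. z x - v x) = 0"
    using nrm_nonneg[OF diff_mem[OF zV v(1)]] by simp
  then have Sv: "S v v" using cong[OF vB z v(1)] by simp
  show ?thesis
  proof (intro bexI[OF _ vB] conjI ballI allI impI Sv)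
    fix w assume w: "w \<in> B r" "S w w"
    have "nrm (\<lambda>x. w x - v x) \<le> k * nrm (\<lambda>x. w x - v x)"
      by (rule contr[OF w(1) vB w(2) Sv])
    then have "(1 - k) * nrm (\<lambda>x. w x - v x) \<le> 0" by (simp add: algebra_simps)
    then show "nrm (\<lambda>x. w x - v x) = 0"
      using k nrm_nonneg[OF diff_mem[OF BV[OF w(1)] v(1)]] by (simp add: mult_le_0_iff)
  next
    fix u n assume u0: "u 0 \<in> B r" and uS: "\<forall>n. u n \<in> B r \<longrightarrow> S (u n) (u (Suc n))"
    have "u n \<in> B r \<and> nrm (\<lambda>x. u n x - v x) \<le> k ^ n * nrm (\<lambda>x. u 0 x - v x)"
    proof (induction n)
      case (Suc n)
      then have "nrm (\<lambda>x. u (Suc n) x - v x) \<le> k * nrm (\<lambda>x. u n x - v x)"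
        using uS by (intro contr vB Sv) auto
      also have "\<dots> \<le> k * (k ^ n * nrm (\<lambda>x. u 0 x - v x))"
        using Suc k by (intro mult_left_mono) auto
      finally show ?case using Suc self uS by (auto simp: mult_ac)
    qed (use u0 in simp)
    then show "u n \<in> B r" "nrm (\<lambda>x. u n x - v x) \<le> k ^ n * nrm (\<lambda>x. u 0 x - v x)"
      by blast+
  qed
qed

end

section \<open>Completeness of the fractional Sobolev space\<close>

text \<open>The cylinder over a null set is null. Pointwise limits can thus be used at both
  coordinates of the integrand of the form.\<close>

lemma AE_lborel_fst:
  fixes P :: "'a::euclidean_space \<Rightarrow> bool"
  assumes "AE x in lborel. P x"
  shows "AE z in (lborel :: ('a \<times> 'b::euclidean_space) measure). P (fst z)"
proof -
  obtain N where N: "N \<in> null_sets lborel" "{x \<in> space lborel. \<not> P x} \<subseteq> N"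
    using assms unfolding eventually_ae_filter by blast
  have "N \<times> UNIV \<in> null_sets (lborel \<Otimes>\<^sub>M lborel :: ('a \<times> 'b) measure)"
    by (rule lborel.times_in_null_sets1) (use N(1) in simp_all)
  then have "N \<times> UNIV \<in> null_sets (lborel :: ('a \<times> 'b) measure)"
    unfolding lborel_prod .
  then show ?thesis
    by (rule AE_I') (use N(2) in auto)
qed

lemma AE_lborel_snd:
  fixes P :: "'b::euclidean_space \<Rightarrow> bool"
  assumes "AE x in lborel. P x"
  shows "AE z in (lborel :: ('a::euclidean_space \<times> 'b) measure). P (snd z)"
proof -
  obtain N where N: "N \<in> null_sets lborel" "{x \<in> space lborel. \<not> P x} \<subseteq> N"
    using assms unfolding eventually_ae_filter by blast
  have "UNIV \<times> N \<in> null_sets (lborel \<Otimes>\<^sub>M lborel :: ('a \<times> 'b) measure)"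
    by (rule lborel.times_in_null_sets2) (use N(1) in simp_all)
  then have "UNIV \<times> N \<in> null_sets (lborel :: ('a \<times> 'b) measure)"
    unfolding lborel_prod .
  then show ?thesis
    by (rule AE_I') (use N(2) in auto)
qed

text \<open>Composition with a projection is immediate only for Borel functions; a Borel
  representative differs from \<open>u\<close> on a null cylinder, which completeness
  absorbs.\<close>

lemma borel_measurable_lebesgue_fst:
  fixes u :: "'a::euclidean_space \<Rightarrow> real"
  assumes "u \<in> borel_measurable lebesgue"
  shows "(\<lambda>z :: 'a \<times> 'b::euclidean_space. u (fst z)) \<in> borel_measurable lebesgue"
proof -
  obtain u' where u': "u' \<in> borel_measurable lborel" "AE x in lborel. u x = u' x"
    using completion_ex_borel_measurable_real[OF assms] by blast
  have "(\<lambda>z :: 'a \<times> 'b. u' (fst z)) \<in> borel_measurable borel"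
    by (rule measurable_compose[of fst borel borel])
      (use u'(1) in \<open>simp_all add: borel_measurable_continuous_onI continuous_on_fst\<close>)
  then have "(\<lambda>z :: 'a \<times> 'b. u' (fst z)) \<in> borel_measurable lebesgue"
    by (simp add: measurable_completion)
  moreover have "AE z in (lebesgue :: ('a \<times> 'b) measure). u' (fst z) = u (fst z)"
    using AE_completion[OF AE_lborel_fst[OF u'(2)]] by eventually_elim simp
  ultimately show ?thesis by (rule borel_measurable_AE)
qed

lemma borel_measurable_lebesgue_snd:
  fixes u :: "'b::euclidean_space \<Rightarrow> real"
  assumes "u \<in> borel_measurable lebesgue"
  shows "(\<lambda>z :: 'a::euclidean_space \<times> 'b. u (snd z)) \<in> borel_measurable lebesgue"
proof -
  obtain u' where u': "u' \<in> borel_measurable lborel" "AE x in lborel. u x = u' x"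
    using completion_ex_borel_measurable_real[OF assms] by blast
  have "(\<lambda>z :: 'a \<times> 'b. u' (snd z)) \<in> borel_measurable borel"
    by (rule measurable_compose[of snd borel borel])
      (use u'(1) in \<open>simp_all add: borel_measurable_continuous_onI continuous_on_snd\<close>)
  then have "(\<lambda>z :: 'a \<times> 'b. u' (snd z)) \<in> borel_measurable lebesgue"
    by (simp add: measurable_completion)
  moreover have "AE z in (lebesgue :: ('a \<times> 'b) measure). u' (snd z) = u (snd z)"
    using AE_completion[OF AE_lborel_snd[OF u'(2)]] by eventually_elim simp
  ultimately show ?thesis by (rule borel_measurable_AE)
qed

section \<open>Passage to the limit in integrals\<close>

lemma integrable_Fatou:
  fixes f :: "nat \<Rightarrow> 'b \<Rightarrow> real"
  assumes int: "\<And>n. integrable M (f n)" and nn: "\<And>n x. 0 \<le> f n x"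
    and bound: "\<And>n. integral\<^sup>L M (f n) \<le> B"
    and g: "g \<in> borel_measurable M" and lim: "AE x in M. (\<lambda>n. f n x) \<longlonglongrightarrow> g x"
  shows "integrable M g" "integral\<^sup>L M g \<le> B"
proof -
  have B: "0 \<le> B"
    using Bochner_Integration.integral_nonneg[of M "f 0"] nn bound[of 0] order_trans by blast
  have gnn: "AE x in M. 0 \<le> g x"
    using lim by eventually_elim (auto intro: LIMSEQ_le_const nn)
  have "(\<integral>\<^sup>+x. ennreal (g x) \<partial>M) = (\<integral>\<^sup>+x. liminf (\<lambda>n. ennreal (f n x)) \<partial>M)"
  proof (rule nn_integral_cong_AE, use lim in eventually_elim)
    case (elim x)
    then have "(\<lambda>n. ennreal (f n x)) \<longlonglongrightarrow> ennreal (g x)" by (rule tendsto_ennrealI)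
    then show ?case by (intro lim_imp_Liminf[symmetric] sequentially_bot)
  qed
  also have "\<dots> \<le> liminf (\<lambda>n. \<integral>\<^sup>+x. ennreal (f n x) \<partial>M)"
    by (intro nn_integral_liminf measurable_compose[OF _ measurable_ennreal] borel_measurable_integrable int)
  also have "\<dots> \<le> liminf (\<lambda>n. ennreal B)"
    using nn_integral_eq_integral[OF int AE_I2[OF nn]]
    by (intro Liminf_mono always_eventually allI) (simp add: bound ennreal_leI)
  finally have le: "(\<integral>\<^sup>+x. ennreal (g x) \<partial>M) \<le> ennreal B"
    by (simp add: Liminf_const)
  show i: "integrable M g"
  proof (rule integrableI_nonneg[OF g gnn])
    show "(\<integral>\<^sup>+x. ennreal (g x) \<partial>M) < \<infinity>"
      using order.strict_trans1[OF le] by simp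
  qed
  show "integral\<^sup>L M g \<le> B"
    using le nn_integral_eq_integral[OF i gnn] B by simp
qed

lemma AE_summable_norm_L1:
  fixes f :: "nat \<Rightarrow> 'b \<Rightarrow> real"
  assumes int: "\<And>n. integrable M (f n)" and sum: "summable (\<lambda>n. LINT x|M. \<bar>f n x\<bar>)"
  shows "AE x in M. summable (\<lambda>n. \<bar>f n x\<bar>)"
proof -
  have m: "(\<lambda>x. ennreal \<bar>f n x\<bar>) \<in> borel_measurable M" for n
    using borel_measurable_integrable[OF integrable_abs[OF int[of n]]] by measurable
  have "(\<integral>\<^sup>+x. (\<Sum>n. ennreal \<bar>f n x\<bar>) \<partial>M) = (\<Sum>n. \<integral>\<^sup>+x. ennreal \<bar>f n x\<bar> \<partial>M)"
    by (rule nn_integral_suminf) (rule m)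
  also have "\<dots> = (\<Sum>n. ennreal (LINT x|M. \<bar>f n x\<bar>))"
    using nn_integral_eq_integral[OF integrable_abs[OF int]] by simp
  also have "\<dots> \<noteq> \<infinity>"
    unfolding infinity_ennreal_def by (rule ennreal_suminf_neq_top[OF sum]) simp
  finally have fin: "(\<integral>\<^sup>+x. (\<Sum>n. ennreal \<bar>f n x\<bar>) \<partial>M) \<noteq> \<infinity>" .
  have "(\<lambda>x. \<Sum>n. ennreal \<bar>f n x\<bar>) \<in> borel_measurable M"
    by (rule borel_measurable_suminf_order) (rule m)
  then have "AE x in M. (\<Sum>n. ennreal \<bar>f n x\<bar>) \<noteq> \<infinity>"
    using fin by (rule nn_integral_PInf_AE)
  then show ?thesis
  proof eventually_elim
    case (elim x)
    then show ?case
      by (intro summable_suminf_not_top) simp_all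
  qed
qed

lemma crit_exp_ge_2:
  assumes "2 \<le> N" "0 < s" "s < 1"
  shows "2 \<le> crit_exp N s"
  using assms by (simp add: crit_exp_def field_simps)

lemma C_frac_pos:
  assumes "0 < s" "s < 1"
  shows "0 < C_frac N s"
  using assms by (auto simp: C_frac_def intro!: divide_pos_pos mult_pos_pos Gamma_real_pos add_nonneg_pos)

section \<open>The energy form as an integral over pairs of points\<close>

definition gagliardo :: "real \<Rightarrow> ('a::euclidean_space \<Rightarrow> real) \<Rightarrow> ('a \<Rightarrow> real) \<Rightarrow> 'a \<times> 'a \<Rightarrow> real" where
  "gagliardo s u v z = (u (fst z) - u (snd z)) * (v (fst z) - v (snd z))
     / norm (fst z - snd z) powr (real DIM('a) + 2 * s)"

lemma Es_eq_gagliardo: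
  fixes u v :: "'a::euclidean_space \<Rightarrow> real"
  shows "Es s u v = C_frac DIM('a) s / 2 * integral\<^sup>L lebesgue (gagliardo s u v)"
  by (simp add: Es_def gagliardo_def[abs_def] case_prod_beta')

lemma Hs_iff:
  "u \<in> Hs s \<longleftrightarrow> u \<in> borel_measurable lebesgue \<and> integrable lebesgue (\<lambda>x. (u x)\<^sup>2) \<and>
     integrable lebesgue (gagliardo s u u)"
proof -
  have p: "\<bar>t\<bar> powr 2 = t\<^sup>2" for t :: real by simp
  have g: "gagliardo s u u = (\<lambda>(x, y). (u x - u y)\<^sup>2 / norm (x - y) powr (real DIM('a) + 2 * s))"
    for u :: "'a \<Rightarrow> real"
    by (auto simp: gagliardo_def fun_eq_iff power2_eq_square)
  show ?thesis by (auto simp: Hs_def Lp_space_def lebesgue_on_UNIV_eq p g)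
qed

lemma gagliardo_nonneg: "0 \<le> gagliardo s u u z"
  by (simp add: gagliardo_def)

lemma borel_measurable_gagliardo:
  fixes u v :: "'a::euclidean_space \<Rightarrow> real"
  assumes "u \<in> borel_measurable lebesgue" "v \<in> borel_measurable lebesgue"
  shows "gagliardo s u v \<in> borel_measurable lebesgue"
proof -
  have "(\<lambda>z :: 'a \<times> 'a. norm (fst z - snd z)) \<in> borel_measurable borel"
    by (intro borel_measurable_continuous_onI continuous_intros)
  then have [measurable]: "(\<lambda>z :: 'a \<times> 'a. norm (fst z - snd z)) \<in> borel_measurable lebesgue"
    by (simp add: measurable_completion)
  note [measurable] = assms[THEN borel_measurable_lebesgue_fst, where 'b='a]
    assms[THEN borel_measurable_lebesgue_snd, where 'a='a]
  show ?thesis unfolding gagliardo_def[abs_def] by measurable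
qed

text \<open>The default value zero of a non-integrable integral could destroy additivity of
  \<open>Es\<close>; the bound \<open>\<bar>a * b\<bar> \<le> a * a + b * b\<close> excludes this
  case.\<close>

lemma integrable_gagliardo:
  fixes u v :: "'a::euclidean_space \<Rightarrow> real"
  assumes "u \<in> Hs s" "v \<in> Hs s"
  shows "integrable lebesgue (gagliardo s u v)"
proof (rule Bochner_Integration.integrable_bound)
  show "integrable lebesgue (\<lambda>z. gagliardo s u u z + gagliardo s v v z)"
    using assms by (auto simp: Hs_iff)
  show "gagliardo s u v \<in> borel_measurable lebesgue"
    using assms by (intro borel_measurable_gagliardo) (auto simp: Hs_iff)
  show "AE z in lebesgue. norm (gagliardo s u v z) \<le> norm (gagliardo s u u z + gagliardo s v v z)"
  proof (rule AE_I2)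
    fix z
    have "\<bar>a * b\<bar> \<le> a * a + b * b" for a b :: real
    proof -
      have "2 * (\<bar>a\<bar> * \<bar>b\<bar>) \<le> \<bar>a\<bar>\<^sup>2 + \<bar>b\<bar>\<^sup>2" using sum_squares_bound[of "\<bar>a\<bar>" "\<bar>b\<bar>"] by simp
      moreover have "0 \<le> \<bar>a\<bar> * \<bar>b\<bar>" by (rule mult_nonneg_nonneg) auto
      ultimately have "\<bar>a\<bar> * \<bar>b\<bar> \<le> \<bar>a\<bar>\<^sup>2 + \<bar>b\<bar>\<^sup>2" by linarith
      then show ?thesis by (simp add: abs_mult power2_eq_square)
    qed
    then have "\<bar>(u (fst z) - u (snd z)) * (v (fst z) - v (snd z))\<bar>
        / norm (fst z - snd z) powr (real DIM('a) + 2 * s) \<le> gagliardo s u u z + gagliardo s v v z"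
      unfolding gagliardo_def add_divide_distrib[symmetric] by (rule divide_right_mono) simp
    then show "norm (gagliardo s u v z) \<le> norm (gagliardo s u u z + gagliardo s v v z)"
      by (simp add: gagliardo_def abs_divide)
  qed
qed

lemma gagliardo_lin:
  "gagliardo s (\<lambda>x. u x + c * v x) w z = gagliardo s u w z + c * gagliardo s v w z"
proof -
  have "((a + c * b) - (a' + c * b')) * d / p = (a - a') * d / p + c * ((b - b') * d / p)"
    for a a' b b' d p :: real
    by (simp add: add_divide_distrib diff_divide_distrib algebra_simps)
  then show ?thesis by (simp add: gagliardo_def)
qed

lemma gagliardo_sym: "gagliardo s u v z = gagliardo s v u z"
  by (simp add: gagliardo_def mult.commute)

lemma Hs_lin:
  assumes u: "u \<in> Hs s" and v: "v \<in> Hs s"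
  shows "(\<lambda>x. u x + c * v x) \<in> Hs s"
proof -
  note u' = u[unfolded Hs_iff] and v' = v[unfolded Hs_iff]
  note [measurable] = u'[THEN conjunct1] v'[THEN conjunct1]
  have "integrable lebesgue (\<lambda>x. (u x + c * v x)\<^sup>2)"
  proof (rule Bochner_Integration.integrable_bound)
    show "integrable lebesgue (\<lambda>x. 2 * (u x)\<^sup>2 + 2 * c\<^sup>2 * (v x)\<^sup>2)"
      using u' v' by auto
    have "(a + c * b)\<^sup>2 \<le> 2 * a\<^sup>2 + 2 * c\<^sup>2 * b\<^sup>2" for a b :: real
      using sum_squares_bound[of a "c * b"] by (simp add: power2_sum power_mult_distrib algebra_simps)
    then show "AE x in lebesgue. norm ((u x + c * v x)\<^sup>2) \<le> norm (2 * (u x)\<^sup>2 + 2 * c\<^sup>2 * (v x)\<^sup>2)"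
      by (intro AE_I2) simp
  qed measurable
  moreover have "integrable lebesgue (gagliardo s (\<lambda>x. u x + c * v x) (\<lambda>x. u x + c * v x))"
  proof -
    have "gagliardo s (\<lambda>x. u x + c * v x) (\<lambda>x. u x + c * v x) = (\<lambda>z. gagliardo s u u z
      + c * gagliardo s v u z + c * (gagliardo s u v z + c * gagliardo s v v z))"
      by (rule ext) (simp only: gagliardo_lin gagliardo_sym[of s _ "\<lambda>x. u x + c * v x"])
    then show ?thesis
      using integrable_gagliardo[OF u v] integrable_gagliardo[OF v u]
        integrable_gagliardo[OF u u] integrable_gagliardo[OF v v] by simp
  qed
  ultimately show ?thesis by (simp add: Hs_iff)
qed

lemma semi_inner_form_X0s:
  fixes \<Omega> :: "'a::euclidean_space set"
  assumes "0 < s" "s < 1"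
  shows "semi_inner_form (X0s s \<Omega>) (Es s)"
proof
  show "(\<lambda>x. 0) \<in> X0s s \<Omega>"
    by (simp add: X0s_def Hs_iff gagliardo_def[abs_def])
  show "(\<lambda>x. u x + c * v x) \<in> X0s s \<Omega>" if "u \<in> X0s s \<Omega>" "v \<in> X0s s \<Omega>" for u v c
    using that by (auto simp: X0s_def Hs_lin elim: eventually_elim2)
  show "Es s u v = Es s v u" for u v :: "'a \<Rightarrow> real"
    by (simp add: Es_eq_gagliardo gagliardo_sym[of s u v, abs_def])
  show "Es s (\<lambda>x. u x + c * v x) w = Es s u w + c * Es s v w"
    if "u \<in> X0s s \<Omega>" "v \<in> X0s s \<Omega>" "w \<in> X0s s \<Omega>" for u v w c
  proof -
    have "integrable lebesgue (gagliardo s u w)" "integrable lebesgue (gagliardo s v w)"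
      using that by (auto simp: X0s_def intro: integrable_gagliardo)
    then show ?thesis
      by (simp add: Es_eq_gagliardo gagliardo_lin[abs_def] distrib_left)
  qed
  show "0 \<le> Es s u u" for u :: "'a \<Rightarrow> real"
    using C_frac_pos[OF assms, of "DIM('a)"]
    by (simp add: Es_eq_gagliardo gagliardo_nonneg)
qed

section \<open>Consequences of the Sobolev inequality and completeness\<close>

context
  fixes \<Omega> :: "'a::euclidean_space set" and s :: real and CS :: "real \<Rightarrow> real"
  assumes dim: "2 \<le> DIM('a)" and open_\<Omega>: "open \<Omega>" and bounded_\<Omega>: "bounded \<Omega>"
    and s: "0 < s" "s < 1" and CS: "sobolev_constants s \<Omega> CS"
begin

interpretation X: semi_inner_form "X0s s \<Omega>" "Es s"
  by (rule semi_inner_form_X0s[OF s])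

lemma nrm_eq_X0s_norm: "X.nrm = X0s_norm s"
  by (simp add: fun_eq_iff X.nrm_def X0s_norm_def)

lemma sobolev_const_pos:
  assumes "1 \<le> p" "p \<le> crit_exp DIM('a) s"
  shows "0 < CS p"
  using CS assms by (simp add: sobolev_constants_def)

lemma X0s_Lp_le:
  assumes u: "u \<in> X0s s \<Omega>" and p: "1 \<le> p" "p \<le> crit_exp DIM('a) s"
  shows "Lp_le (lebesgue_on \<Omega>) p (CS p * X0s_norm s u) u"
proof -
  have Lp: "u \<in> Lp_space p \<Omega>" "Lp_norm p \<Omega> u \<le> CS p * X0s_norm s u"
    using CS u p unfolding sobolev_constants_def by blast+
  let ?I = "LINT x|lebesgue_on \<Omega>. \<bar>u x\<bar> powr p"
  have "0 \<le> ?I" by (rule Bochner_Integration.integral_nonneg) simp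
  then have "?I = (?I powr (1 / p)) powr p"
    using p by (simp add: powr_powr)
  also have "\<dots> \<le> (CS p * X0s_norm s u) powr p"
    using Lp(2) p by (intro powr_mono2) (simp_all add: Lp_norm_def)
  finally show ?thesis
    using Lp(1) by (simp add: Lp_le_def Lp_space_def)
qed

lemma exponents: "1 \<le> crit_exp DIM('a) s" "2 \<le> crit_exp DIM('a) s"
  using crit_exp_ge_2[OF dim s] by auto

lemma X0s_L1:
  assumes "u \<in> X0s s \<Omega>"
  shows "integrable (lebesgue_on \<Omega>) (\<lambda>x. \<bar>u x\<bar>)"
    "(LINT x|lebesgue_on \<Omega>. \<bar>u x\<bar>) \<le> CS 1 * X0s_norm s u"
proof -
  have "0 \<le> CS 1 * X0s_norm s u"
    using sobolev_const_pos[of 1] exponents X.nrm_nonneg[OF assms] by (simp add: nrm_eq_X0s_norm)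
  then show "integrable (lebesgue_on \<Omega>) (\<lambda>x. \<bar>u x\<bar>)"
    "(LINT x|lebesgue_on \<Omega>. \<bar>u x\<bar>) \<le> CS 1 * X0s_norm s u"
    using X0s_Lp_le[OF assms, of 1] exponents by (simp_all add: Lp_le_def)
qed

lemma sets_\<Omega>: "\<Omega> \<inter> space lebesgue \<in> sets lebesgue"
  using open_\<Omega> by (simp add: borel_open)

lemma AE_lebesgue_split:
  assumes "AE x in lebesgue_on \<Omega>. P x" "AE x in lebesgue. x \<notin> \<Omega> \<longrightarrow> P x"
  shows "AE x in lebesgue. P x"
proof -
  have "AE x in lebesgue. x \<in> \<Omega> \<longrightarrow> P x"
    using assms(1) unfolding AE_restrict_space_iff[OF sets_\<Omega>] .
  with assms(2) show ?thesis
    by eventually_elim blast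
qed

text \<open>The case \<open>p = 1\<close> of the Sobolev inequality forces the integral over
  \<open>\<Omega>\<close> to vanish. This turns every conclusion about norm zero into equality
  almost everywhere.\<close>

lemma X0s_norm_eq_0:
  assumes u: "u \<in> X0s s \<Omega>" and 0: "X0s_norm s u = 0"
  shows "AE x in lebesgue. u x = 0"
proof -
  have "0 \<le> (LINT x|lebesgue_on \<Omega>. \<bar>u x\<bar>)"
    by (rule Bochner_Integration.integral_nonneg) simp
  with X0s_L1(2)[OF u] have "(LINT x|lebesgue_on \<Omega>. \<bar>u x\<bar>) = 0"
    unfolding 0 by linarith
  then have "AE x in lebesgue_on \<Omega>. \<bar>u x\<bar> = 0"
    using integral_nonneg_eq_0_iff_AE[OF X0s_L1(1)[OF u]] by simp
  then have "AE x in lebesgue_on \<Omega>. u x = 0" by simp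
  moreover have "AE x in lebesgue. x \<notin> \<Omega> \<longrightarrow> u x = 0"
    using u by (simp add: X0s_def)
  ultimately show ?thesis
    by (rule AE_lebesgue_split)
qed

text \<open>Membership in \<open>Hs\<close> asks for square integrability on the whole space,
  whereas the Sobolev inequality speaks of \<open>\<Omega>\<close> only; vanishing outside
  \<open>\<Omega>\<close> bridges the gap.\<close>

lemma X0s_L2_le:
  assumes u: "u \<in> X0s s \<Omega>"
  shows "(LINT x|lebesgue. (u x)\<^sup>2) \<le> (CS 2 * X0s_norm s u)\<^sup>2"
proof -
  have nn: "0 \<le> CS 2 * X0s_norm s u"
    using sobolev_const_pos[of 2] exponents X.nrm_nonneg[OF u] by (simp add: nrm_eq_X0s_norm)
  have [measurable]: "u \<in> borel_measurable lebesgue"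
    using u by (simp add: X0s_def Hs_iff)
  have [measurable]: "\<Omega> \<in> sets lebesgue" using sets_\<Omega> by simp
  have "AE x in lebesgue. x \<notin> \<Omega> \<longrightarrow> u x = 0"
    using u by (simp add: X0s_def)
  then have "AE x in lebesgue. (u x)\<^sup>2 = indicator \<Omega> x *\<^sub>R (u x)\<^sup>2"
    by eventually_elim (simp split: split_indicator)
  then have "(LINT x|lebesgue. (u x)\<^sup>2) = (LINT x|lebesgue. indicator \<Omega> x *\<^sub>R (u x)\<^sup>2)"
    by (rule integral_cong_AE[rotated 2]) measurable
  also have "\<dots> = (LINT x|lebesgue_on \<Omega>. (u x)\<^sup>2)"
    by (rule integral_restrict_space[OF sets_\<Omega>, symmetric])
  also have "\<dots> \<le> (CS 2 * X0s_norm s u)\<^sup>2"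
    using Lp_leD(3)[OF X0s_Lp_le[OF u, of 2]] exponents nn by simp
  finally show ?thesis .
qed

lemma X0s_complete:
  assumes us: "\<And>n. us n \<in> X0s s \<Omega>"
    and sum: "summable (\<lambda>n. X0s_norm s (\<lambda>x. us (Suc n) x - us n x))"
  shows "\<exists>v\<in>X0s s \<Omega>. (\<lambda>n. X0s_norm s (\<lambda>x. us n x - v x)) \<longlonglongrightarrow> 0"
proof -
  define d where "d = (\<lambda>n x. us (Suc n) x - us n x)"
  have d: "d n \<in> X0s s \<Omega>" for n
    unfolding d_def by (intro X.diff_mem us)
  have sum_d: "summable (\<lambda>n. X0s_norm s (d n))"
    using sum by (simp add: d_def)
  have Hs: "us n \<in> Hs s" "us n \<in> borel_measurable lebesgue" "AE x in lebesgue. x \<notin> \<Omega> \<longrightarrow> us n x = 0" for n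
    using us[of n] by (auto simp: X0s_def Hs_iff)
  \<comment> \<open>\<open>lim\<close> has some value also where the sequence diverges. Those points
    will form a null set, and measurability of \<open>v\<close> does not depend on them.\<close>
  define v where "v = (\<lambda>x. lim (\<lambda>n. us n x))"
  have v_meas: "v \<in> borel_measurable lebesgue"
    unfolding v_def by (intro borel_measurable_lim_metric Hs)
  have int_abs: "integrable (lebesgue_on \<Omega>) (d n)" for n
    using X0s_L1(1)[OF d[of n]] Lp_leD(1)[OF X0s_Lp_le[OF d[of n], of 1]] exponents
    by (simp add: integrable_abs_iff)
  have "summable (\<lambda>n. LINT x|lebesgue_on \<Omega>. \<bar>d n x\<bar>)"
  proof (rule summable_comparison_test')
    show "summable (\<lambda>n. CS 1 * X0s_norm s (d n))" by (intro summable_mult sum_d)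
    show "norm (LINT x|lebesgue_on \<Omega>. \<bar>d n x\<bar>) \<le> CS 1 * X0s_norm s (d n)" if "0 \<le> n" for n
      using X0s_L1(2)[OF d[of n]] by simp
  qed
  then have "AE x in lebesgue_on \<Omega>. summable (\<lambda>n. \<bar>d n x\<bar>)"
    by (rule AE_summable_norm_L1[OF int_abs])
  then have conv_\<Omega>: "AE x in lebesgue_on \<Omega>. convergent (\<lambda>n. us n x)"
  proof eventually_elim
    case (elim x)
    then have "summable (\<lambda>n. d n x)" by (rule summable_rabs_cancel)
    then have "convergent (\<lambda>n. us n x - us 0 x)"
      unfolding summable_iff_convergent d_def by (simp only: sum_lessThan_telescope[of "\<lambda>n. us n x"])
    then have "convergent (\<lambda>n. (us n x - us 0 x) + us 0 x)"
      by (intro convergent_add convergent_const)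
    then show ?case by simp
  qed
  have zero: "AE x in lebesgue. \<forall>n. x \<notin> \<Omega> \<longrightarrow> us n x = 0"
    unfolding AE_all_countable using Hs(3) by blast
  then have zero': "AE x in lebesgue. x \<notin> \<Omega> \<longrightarrow> (\<forall>n. us n x = 0)"
    by eventually_elim blast
  have "AE x in lebesgue. x \<notin> \<Omega> \<longrightarrow> convergent (\<lambda>n. us n x)"
    using zero' by eventually_elim (simp add: convergent_const)
  with conv_\<Omega> have "AE x in lebesgue. convergent (\<lambda>n. us n x)"
    by (rule AE_lebesgue_split)
  then have lim: "AE x in lebesgue. (\<lambda>n. us n x) \<longlonglongrightarrow> v x"
    by eventually_elim (simp add: v_def convergent_LIMSEQ_iff)
  have v_zero: "AE x in lebesgue. x \<notin> \<Omega> \<longrightarrow> v x = 0"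
    using zero' by eventually_elim (simp add: v_def)
  have lim2: "AE z in lebesgue. (\<lambda>n. us n (fst z)) \<longlonglongrightarrow> v (fst z)"
      "AE z in lebesgue. (\<lambda>n. us n (snd z)) \<longlonglongrightarrow> v (snd z)"
    using lim unfolding AE_completion_iff by (rule AE_lborel_fst, rule AE_lborel_snd)
  \<comment> \<open>This bounds the distance of \<open>us m\<close> from all later terms. Being
    independent of the later index, the bound survives Fatou's lemma.\<close>
  define tail where "tail = (\<lambda>m. \<Sum>i. X0s_norm s (d (i + m)))"
  have tail_lim: "tail \<longlonglongrightarrow> 0"
  proof -
    have "tail = (\<lambda>m. (\<Sum>i. X0s_norm s (d i)) - (\<Sum>i<m. X0s_norm s (d i)))"
      unfolding tail_def by (intro ext suminf_minus_initial_segment sum_d)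
    then show ?thesis
      using tendsto_diff[OF tendsto_const[of "\<Sum>i. X0s_norm s (d i)"] summable_LIMSEQ[OF sum_d]] by simp
  qed
  have dist: "X0s_norm s (\<lambda>x. us m x - us (n + m) x) \<le> tail m" for m n
  proof -
    have "X0s_norm s (\<lambda>x. us (n + m) x - us m x) \<le> (\<Sum>i<n. X0s_norm s (d (i + m)))"
    proof (induction n)
      case 0
      have "X0s_norm s (\<lambda>x :: 'a. 0) = 0"
        using X.nrm_scale[OF X.zero_mem, of 0] by (simp add: nrm_eq_X0s_norm)
      then show ?case by simp
    next
      case (Suc n)
      have "X0s_norm s (\<lambda>x. us (Suc n + m) x - us m x)
        \<le> X0s_norm s (d (n + m)) + X0s_norm s (\<lambda>x. us (n + m) x - us m x)"
        using X.nrm_triangle[OF us[of "Suc n + m"] us[of "n + m"] us[of m]]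
        by (simp add: nrm_eq_X0s_norm d_def)
      then show ?case using Suc by simp
    qed
    also have "\<dots> \<le> tail m"
      unfolding tail_def using X.nrm_nonneg[OF d]
      by (intro sum_le_suminf summable_ignore_initial_segment[OF sum_d]) (simp_all add: nrm_eq_X0s_norm)
    finally show ?thesis
      using X.nrm_minus_commute[OF us[of m] us[of "n + m"]] by (simp add: nrm_eq_X0s_norm)
  qed
  have tail_nn: "0 \<le> tail m" for m
    using X.nrm_nonneg[OF X.diff_mem[OF us[of m] us[of m]]] dist[of m 0] by (simp add: nrm_eq_X0s_norm)
  define C where "C = C_frac DIM('a) s / 2"
  have C: "0 < C" using C_frac_pos[OF s] by (simp add: C_def)
  have main: "(\<lambda>x. us m x - v x) \<in> X0s s \<Omega>" "X0s_norm s (\<lambda>x. us m x - v x) \<le> tail m" for m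
  proof -
    \<comment> \<open>The shift by \<open>m\<close> makes the bound by \<open>tail m\<close> hold
      for every \<open>n\<close>, as the Fatou lemma requires.\<close>
    define e where "e = (\<lambda>n x. us m x - us (n + m) x)"
    define w where "w = (\<lambda>x. us m x - v x)"
    have e: "e n \<in> X0s s \<Omega>" for n unfolding e_def by (intro X.diff_mem us)
    have eH: "e n \<in> Hs s" for n using e[of n] by (simp add: X0s_def)
    have e_lim: "AE x in lebesgue. (\<lambda>n. e n x) \<longlonglongrightarrow> w x"
      using lim unfolding e_def w_def
      by eventually_elim (intro tendsto_intros LIMSEQ_ignore_initial_segment)
    have e_lim2: "AE z in lebesgue. (\<lambda>n. gagliardo s (e n) (e n) z) \<longlonglongrightarrow> gagliardo s w w z"
      using lim2
    proof eventually_elim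
      case (elim z)
      have "(\<lambda>n. e n (fst z) - e n (snd z)) \<longlonglongrightarrow> w (fst z) - w (snd z)"
        unfolding e_def w_def by (intro tendsto_intros LIMSEQ_ignore_initial_segment elim)
      then show ?case
        unfolding gagliardo_def divide_inverse by (intro tendsto_mult tendsto_const)
    qed
    have w_meas: "w \<in> borel_measurable lebesgue"
      unfolding w_def by (intro borel_measurable_diff Hs v_meas)
    have e_norm: "X0s_norm s (e n) \<le> tail m" "0 \<le> X0s_norm s (e n)" for n
      using dist[of m n] X.nrm_nonneg[OF e[of n]] by (simp_all add: e_def nrm_eq_X0s_norm)
    have i2: "integrable lebesgue (\<lambda>x. (w x)\<^sup>2)"
    proof (rule integrable_Fatou(1))
      show "integrable lebesgue (\<lambda>x. (e n x)\<^sup>2)" for n using eH[of n] by (simp add: Hs_iff)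
      show "(LINT x|lebesgue. (e n x)\<^sup>2) \<le> (CS 2 * tail m)\<^sup>2" for n
        using X0s_L2_le[OF e[of n]] e_norm[of n] sobolev_const_pos[of 2] exponents
        by (elim order_trans) (intro power_mono mult_left_mono, simp_all)
      show "(\<lambda>x. (w x)\<^sup>2) \<in> borel_measurable lebesgue" using w_meas by measurable
      show "AE x in lebesgue. (\<lambda>n. (e n x)\<^sup>2) \<longlonglongrightarrow> (w x)\<^sup>2"
        using e_lim by eventually_elim (rule tendsto_power)
    qed simp
    have ig: "integrable lebesgue (gagliardo s w w)"
      and le: "integral\<^sup>L lebesgue (gagliardo s w w) \<le> (tail m)\<^sup>2 / C"
    proof -
      have int: "integrable lebesgue (gagliardo s (e n) (e n))" for n
        using eH[of n] by (simp add: Hs_iff)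
      have bound: "integral\<^sup>L lebesgue (gagliardo s (e n) (e n)) \<le> (tail m)\<^sup>2 / C" for n
      proof -
        have "C * integral\<^sup>L lebesgue (gagliardo s (e n) (e n)) = (X0s_norm s (e n))\<^sup>2"
          using X.nrm_square[OF e[of n]] by (simp add: Es_eq_gagliardo C_def nrm_eq_X0s_norm)
        also have "\<dots> \<le> (tail m)\<^sup>2"
          by (intro power_mono e_norm)
        finally show ?thesis using C by (simp add: pos_le_divide_eq mult.commute)
      qed
      show "integrable lebesgue (gagliardo s w w)"
        by (rule integrable_Fatou(1)[OF int gagliardo_nonneg bound borel_measurable_gagliardo[OF w_meas w_meas] e_lim2])
      show "integral\<^sup>L lebesgue (gagliardo s w w) \<le> (tail m)\<^sup>2 / C"
        by (rule integrable_Fatou(2)[OF int gagliardo_nonneg bound borel_measurable_gagliardo[OF w_meas w_meas] e_lim2])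
    qed
    have w_zero: "AE x in lebesgue. x \<notin> \<Omega> \<longrightarrow> w x = 0"
      using v_zero Hs(3)[of m] unfolding w_def by eventually_elim simp
    show "(\<lambda>x. us m x - v x) \<in> X0s s \<Omega>"
      using w_meas i2 ig w_zero unfolding w_def[symmetric] by (simp add: X0s_def Hs_iff)
    have "Es s w w \<le> (tail m)\<^sup>2"
      using le C by (simp add: Es_eq_gagliardo C_def[symmetric] pos_le_divide_eq mult.commute)
    then show "X0s_norm s (\<lambda>x. us m x - v x) \<le> tail m"
      unfolding w_def[symmetric] X0s_norm_def using tail_nn by (intro real_le_lsqrt) simp_all
  qed
  \<comment> \<open>Membership is known first for the differences \<open>us m - v\<close>;
    subtracting one of them from \<open>us m\<close> recovers \<open>v\<close>.\<close>
  have "v \<in> X0s s \<Omega>"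
    using X.diff_mem[OF us[of 0] main(1)[of 0]] by simp
  moreover have "(\<lambda>n. X0s_norm s (\<lambda>x. us n x - v x)) \<longlonglongrightarrow> 0"
  proof (rule Lim_null_comparison[OF _ tail_lim])
    show "eventually (\<lambda>n. norm (X0s_norm s (\<lambda>x. us n x - v x)) \<le> tail n) sequentially"
      using main X.nrm_nonneg[OF main(1)] by (simp add: nrm_eq_X0s_norm)
  qed
  ultimately show ?thesis by blast
qed

lemma complete_form_X0s: "complete_form (X0s s \<Omega>) (Es s)"
  by unfold_locales (use X0s_complete in \<open>simp add: X0s_norm_def\<close>)

end

section \<open>The solution operator\<close>

text \<open>A real supremum is meaningful only for a bounded set, which the constant
  \<open>C\<close> from the definition of the dual guarantees. Functions of norm zero cannot be
  normalized, but boundedness gives \<open>f u = 0\<close> for them.\<close>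

lemma X0s_dual_le:
  assumes X: "semi_inner_form (X0s s \<Omega>) (Es s)" and f: "f \<in> X0s_dual s \<Omega>" and u: "u \<in> X0s s \<Omega>"
  shows "\<bar>f u\<bar> \<le> X0s_dual_norm s \<Omega> f * X0s_norm s u"
proof -
  interpret X: semi_inner_form "X0s s \<Omega>" "Es s" by (rule X)
  have nrm: "X.nrm = X0s_norm s" by (simp add: fun_eq_iff X.nrm_def X0s_norm_def)
  obtain C where C: "\<And>u. u \<in> X0s s \<Omega> \<Longrightarrow> \<bar>f u\<bar> \<le> C * X0s_norm s u"
    using f unfolding X0s_dual_def by blast
  have scale: "f (\<lambda>x. c * u x) = c * f u" for c
    using f u by (simp add: X0s_dual_def)
  show ?thesis
  proof (cases "X0s_norm s u = 0")
    case True
    then show ?thesis using C[OF u] by simp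
  next
    case False
    then have pos: "0 < X0s_norm s u" using X.nrm_nonneg[OF u] by (simp add: nrm)
    let ?w = "\<lambda>x. (1 / X0s_norm s u) * u x"
    have "X0s_norm s ?w = 1"
      using X.nrm_scale[OF u, of "1 / X0s_norm s u"] pos unfolding nrm by simp
    then have w: "?w \<in> X0s_ball s \<Omega> 1"
      unfolding X0s_ball_def using X.scale_mem[OF u, of "1 / X0s_norm s u"] by (simp del: times_divide_eq_left)
    have "bdd_above ((\<lambda>u. \<bar>f u\<bar>) ` X0s_ball s \<Omega> 1)"
    proof (rule bdd_aboveI2)
      fix v assume "v \<in> X0s_ball s \<Omega> 1"
      then have v: "v \<in> X0s s \<Omega>" "X0s_norm s v \<le> 1" by (auto simp: X0s_ball_def)
      have "\<bar>f v\<bar> \<le> C * X0s_norm s v" by (rule C[OF v(1)])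
      also have "\<dots> \<le> \<bar>C\<bar> * 1"
        using v X.nrm_nonneg[OF v(1)] by (intro mult_mono) (simp_all add: nrm)
      finally show "\<bar>f v\<bar> \<le> \<bar>C\<bar> * 1" .
    qed
    then have "\<bar>f ?w\<bar> \<le> X0s_dual_norm s \<Omega> f"
      unfolding X0s_dual_norm_def by (rule cSUP_upper[OF w])
    then have "\<bar>f u\<bar> / X0s_norm s u \<le> X0s_dual_norm s \<Omega> f"
      unfolding scale using pos by (simp add: abs_mult)
    then show ?thesis using pos by (simp add: pos_divide_le_eq)
  qed
qed

text \<open>The functional \<open>f\<close> is kept apart because it cancels when two inputs
  \<open>u\<close> are compared. The expression is linear in the test function only.\<close>

definition source_form ::
    "'a::euclidean_space set \<Rightarrow> ('a \<Rightarrow> real) \<Rightarrow> ('a \<times> 'a \<Rightarrow> real) \<Rightarrow> ('a \<times> 'a \<Rightarrow> real) \<Rightarrow>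
     real \<Rightarrow> real \<Rightarrow> ('a \<Rightarrow> real) \<Rightarrow> ('a \<Rightarrow> real) \<Rightarrow> real" where
  "source_form \<Omega> a K Q q lam u \<phi> =
     (LINT x|lebesgue_on \<Omega>. (a x * u x + TK \<Omega> K u x + lam * NQ \<Omega> Q q u x) * \<phi> x)"

section \<open>Growth and Lipschitz estimates for the right-hand side\<close>

context
  fixes \<Omega> :: "'a::euclidean_space set" and s q lam :: real and CS :: "real \<Rightarrow> real"
    and a :: "'a \<Rightarrow> real" and K Q :: "'a \<times> 'a \<Rightarrow> real"
  assumes dim: "2 \<le> DIM('a)" and open_\<Omega>: "open \<Omega>" and bounded_\<Omega>: "bounded \<Omega>"
    and s: "0 < s" "s < 1" and CS: "sobolev_constants s \<Omega> CS"
    and q: "2 \<le> q" "q < crit_exp DIM('a) s"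
    and a: "a \<in> Linf_space \<Omega>" and K: "K \<in> Linf_space (\<Omega> \<times> \<Omega>)" and Q: "Q \<in> Linf_space (\<Omega> \<times> \<Omega>)"
begin

interpretation X: complete_form "X0s s \<Omega>" "Es s"
  by (rule complete_form_X0s[OF dim open_\<Omega> bounded_\<Omega> s CS])

lemma X0s_norm_nonneg: "u \<in> X0s s \<Omega> \<Longrightarrow> 0 \<le> X0s_norm s u"
  using X.nrm_nonneg by (simp add: X.nrm_def X0s_norm_def)

lemma CS_pos: "0 < CS 2" "0 < CS q"
  using sobolev_const_pos[OF dim open_\<Omega> bounded_\<Omega> s CS] q by auto

lemma CS_norm_nonneg:
  assumes "u \<in> X0s s \<Omega>"
  shows "0 \<le> CS 2 * X0s_norm s u" "0 \<le> CS q * X0s_norm s u"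
  using X0s_norm_nonneg[OF assms] CS_pos by simp_all

lemma X0s_L2_Lq:
  assumes "u \<in> X0s s \<Omega>"
  shows "Lp_le (lebesgue_on \<Omega>) 2 (CS 2 * X0s_norm s u) u"
    "Lp_le (lebesgue_on \<Omega>) q (CS q * X0s_norm s u) u"
  using X0s_Lp_le[OF dim open_\<Omega> bounded_\<Omega> s CS assms] q by auto

lemma X0s_ball_Lq:
  assumes "u \<in> X0s s \<Omega>" "X0s_norm s u \<le> r"
  shows "Lp_le (lebesgue_on \<Omega>) q (CS q * r) u"
  using Lp_le_mono[OF X0s_L2_Lq(2)[OF assms(1)] CS_norm_nonneg(2)[OF assms(1)], of "CS q * r"]
    assms(2) CS_pos q by simp

lemma source_form_integrable:
  assumes u: "u \<in> X0s s \<Omega>" and \<phi>: "\<phi> \<in> X0s s \<Omega>"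
  shows "integrable (lebesgue_on \<Omega>) (\<lambda>x. a x * u x * \<phi> x)"
    "integrable (lebesgue_on \<Omega>) (\<lambda>x. TK \<Omega> K u x * \<phi> x)"
    "integrable (lebesgue_on \<Omega>) (\<lambda>x. NQ \<Omega> Q q u x * \<phi> x)"
proof -
  note c = CS_norm_nonneg[OF u] CS_norm_nonneg[OF \<phi>]
  note b = X0s_L2_Lq[OF u] X0s_L2_Lq[OF \<phi>]
  show "integrable (lebesgue_on \<Omega>) (\<lambda>x. a x * u x * \<phi> x)"
    by (rule Linf_mult_bound(1)[OF a c(1) c(3) b(1) b(3)])
  show "integrable (lebesgue_on \<Omega>) (\<lambda>x. TK \<Omega> K u x * \<phi> x)"
    by (rule TK_bound(1)[OF open_\<Omega> bounded_\<Omega> K c(1) c(3) b(1) b(3)])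
  \<comment> \<open>\<open>NQ_bound\<close> asks for a positive bound, while the norm itself may be
    zero.\<close>
  have r: "0 < X0s_norm s u + 1" using X0s_norm_nonneg[OF u] by simp
  then have "0 < CS q * (X0s_norm s u + 1)" using CS_pos by simp
  then show "integrable (lebesgue_on \<Omega>) (\<lambda>x. NQ \<Omega> Q q u x * \<phi> x)"
    by (rule NQ_bound(1)[OF open_\<Omega> bounded_\<Omega> Q q(1) _ c(4) X0s_ball_Lq[OF u] b(4)]) simp
qed

text \<open>Splitting the integral is legitimate because all three terms are integrable. It links
  the single integral in \<open>sol_op\<close> with the separate integrals in
  \<open>As\<close>.\<close>

lemma source_form_eq:
  assumes u: "u \<in> X0s s \<Omega>" and \<phi>: "\<phi> \<in> X0s s \<Omega>"
  shows "source_form \<Omega> a K Q q lam u \<phi> = (LINT x|lebesgue_on \<Omega>. a x * u x * \<phi> x)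
    + (LINT x|lebesgue_on \<Omega>. TK \<Omega> K u x * \<phi> x) + lam * (LINT x|lebesgue_on \<Omega>. NQ \<Omega> Q q u x * \<phi> x)"
proof -
  note i = source_form_integrable[OF u \<phi>]
  have "source_form \<Omega> a K Q q lam u \<phi> = (LINT x|lebesgue_on \<Omega>. a x * u x * \<phi> x
    + TK \<Omega> K u x * \<phi> x + lam * (NQ \<Omega> Q q u x * \<phi> x))"
    unfolding source_form_def by (simp add: distrib_right mult.assoc)
  also have "\<dots> = (LINT x|lebesgue_on \<Omega>. a x * u x * \<phi> x)
    + (LINT x|lebesgue_on \<Omega>. TK \<Omega> K u x * \<phi> x) + lam * (LINT x|lebesgue_on \<Omega>. NQ \<Omega> Q q u x * \<phi> x)"
    using i by simp
  finally show ?thesis .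
qed

lemma source_form_lin:
  assumes u: "u \<in> X0s s \<Omega>" and \<phi>: "\<phi> \<in> X0s s \<Omega>" and \<psi>: "\<psi> \<in> X0s s \<Omega>"
  shows "source_form \<Omega> a K Q q lam u (\<lambda>x. \<phi> x + c * \<psi> x)
    = source_form \<Omega> a K Q q lam u \<phi> + c * source_form \<Omega> a K Q q lam u \<psi>"
proof -
  let ?g = "\<lambda>x. a x * u x + TK \<Omega> K u x + lam * NQ \<Omega> Q q u x"
  have i: "integrable (lebesgue_on \<Omega>) (\<lambda>x. ?g x * \<phi> x)" if "\<phi> \<in> X0s s \<Omega>" for \<phi>
  proof -
    have "integrable (lebesgue_on \<Omega>) (\<lambda>x. a x * u x * \<phi> x + TK \<Omega> K u x * \<phi> x + lam * (NQ \<Omega> Q q u x * \<phi> x))"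
      using source_form_integrable[OF u that] by simp
    then show ?thesis by (simp add: distrib_right mult.assoc)
  qed
  have "source_form \<Omega> a K Q q lam u (\<lambda>x. \<phi> x + c * \<psi> x)
      = (LINT x|lebesgue_on \<Omega>. ?g x * \<phi> x + c * (?g x * \<psi> x))"
    unfolding source_form_def by (simp add: distrib_left mult.left_commute)
  also have "\<dots> = source_form \<Omega> a K Q q lam u \<phi> + c * source_form \<Omega> a K Q q lam u \<psi>"
    unfolding source_form_def
    by (subst Bochner_Integration.integral_add)
      (simp_all only: i \<phi> \<psi> integrable_mult_right integral_mult_right_zero)
  finally show ?thesis .
qed

text \<open>Collects the Sobolev constants: \<open>2 * q - 2\<close> from the power of the radius
  and one from each of the two remaining factors.\<close>

lemma CS_powr_scale:
  assumes "0 < r"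
  shows "(CS q * r) powr (2 * q - 2) * ((CS q * x) * (CS q * y))
    = CS q powr (2 * q) * r powr (2 * q - 2) * (x * y)"
proof -
  have "CS q powr (2 * q) = CS q powr (2 * q - 2) * (CS q)\<^sup>2"
    using CS_pos powr_add[of "CS q" "2 * q - 2" 2] by simp
  then show ?thesis
    using CS_pos assms by (simp add: powr_mult power2_eq_square mult_ac)
qed

lemma linear_source_bound:
  assumes u: "u \<in> X0s s \<Omega>" and \<phi>: "\<phi> \<in> X0s s \<Omega>"
  shows "\<bar>LINT x|lebesgue_on \<Omega>. a x * u x * \<phi> x\<bar> + \<bar>LINT x|lebesgue_on \<Omega>. TK \<Omega> K u x * \<phi> x\<bar>
    \<le> (CS 2)\<^sup>2 * (Linf_norm \<Omega> a + measure lebesgue \<Omega> * Linf_norm (\<Omega> \<times> \<Omega>) K)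
        * (X0s_norm s u * X0s_norm s \<phi>)"
proof -
  note c = CS_norm_nonneg[OF u] CS_norm_nonneg[OF \<phi>]
  note b = X0s_L2_Lq[OF u] X0s_L2_Lq[OF \<phi>]
  have "\<bar>LINT x|lebesgue_on \<Omega>. a x * u x * \<phi> x\<bar> + \<bar>LINT x|lebesgue_on \<Omega>. TK \<Omega> K u x * \<phi> x\<bar>
    \<le> Linf_norm \<Omega> a * ((CS 2 * X0s_norm s u) * (CS 2 * X0s_norm s \<phi>))
      + measure lebesgue \<Omega> * Linf_norm (\<Omega> \<times> \<Omega>) K * ((CS 2 * X0s_norm s u) * (CS 2 * X0s_norm s \<phi>))"
    by (rule add_mono[OF Linf_mult_bound(2)[OF a c(1) c(3) b(1) b(3)]
      TK_bound(2)[OF open_\<Omega> bounded_\<Omega> K c(1) c(3) b(1) b(3)]])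
  then show ?thesis by (simp add: power2_eq_square algebra_simps)
qed

text \<open>The coefficient in parentheses is \<open>\<eta> + \<gamma> * r powr (2 * q - 2)\<close>.
  One factor \<open>r\<close> stays outside it, to be weighed against the dual norm of
  \<open>f\<close>.\<close>

lemma source_form_bound:
  assumes u: "u \<in> X0s s \<Omega>" "X0s_norm s u \<le> r" and r: "0 < r" and \<phi>: "\<phi> \<in> X0s s \<Omega>"
  shows "\<bar>source_form \<Omega> a K Q q lam u \<phi>\<bar>
    \<le> ((CS 2)\<^sup>2 * (Linf_norm \<Omega> a + measure lebesgue \<Omega> * Linf_norm (\<Omega> \<times> \<Omega>) K)
        + \<bar>lam\<bar> * Linf_norm (\<Omega> \<times> \<Omega>) Q * CS q powr (2 * q) * r powr (2 * q - 2)) * r * X0s_norm s \<phi>"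
proof -
  let ?k = "Linf_norm (\<Omega> \<times> \<Omega>) Q"
  let ?e = "(CS 2)\<^sup>2 * (Linf_norm \<Omega> a + measure lebesgue \<Omega> * Linf_norm (\<Omega> \<times> \<Omega>) K)"
  have b: "0 < CS q * r" using CS_pos r by simp
  have e: "0 \<le> ?e" using Linf_norm_nonneg[OF a] Linf_norm_nonneg[OF K] by simp
  have "\<bar>LINT x|lebesgue_on \<Omega>. NQ \<Omega> Q q u x * \<phi> x\<bar>
      \<le> ?k * (CS q * r) powr (2 * q - 2) * ((CS q * r) * (CS q * X0s_norm s \<phi>))"
    by (rule NQ_bound(2)[OF open_\<Omega> bounded_\<Omega> Q q(1) b CS_norm_nonneg(2)[OF \<phi>] X0s_ball_Lq[OF u]
      X0s_L2_Lq(2)[OF \<phi>]])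
  also have "\<dots> = ?k * (CS q powr (2 * q) * r powr (2 * q - 2) * (r * X0s_norm s \<phi>))"
    unfolding mult.assoc[of ?k] CS_powr_scale[OF r] ..
  finally have N: "\<bar>lam * (LINT x|lebesgue_on \<Omega>. NQ \<Omega> Q q u x * \<phi> x)\<bar>
      \<le> \<bar>lam\<bar> * (?k * (CS q powr (2 * q) * r powr (2 * q - 2) * (r * X0s_norm s \<phi>)))"
    unfolding abs_mult by (intro mult_left_mono) simp_all
  have "?e * (X0s_norm s u * X0s_norm s \<phi>) \<le> ?e * (r * X0s_norm s \<phi>)"
    by (intro mult_left_mono mult_right_mono u e X0s_norm_nonneg \<phi>)
  with N linear_source_bound[OF u(1) \<phi>] have "\<bar>source_form \<Omega> a K Q q lam u \<phi>\<bar>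
      \<le> ?e * (r * X0s_norm s \<phi>) + \<bar>lam\<bar> * (?k * (CS q powr (2 * q) * r powr (2 * q - 2) * (r * X0s_norm s \<phi>)))"
    unfolding source_form_eq[OF u(1) \<phi>] by linarith
  then show ?thesis by (simp add: algebra_simps)
qed

text \<open>The two linear terms reduce to their values at \<open>u - v\<close>, pointwise for
  \<open>a\<close> and almost everywhere for \<open>TK\<close>, so
  \<open>linear_source_bound\<close> applies to the difference. With the nonlinear term the
  coefficient becomes \<open>\<kappa>\<close>.\<close>

lemma source_form_diff_bound:
  assumes u: "u \<in> X0s s \<Omega>" "X0s_norm s u \<le> r" and v: "v \<in> X0s s \<Omega>" "X0s_norm s v \<le> r"
    and r: "0 < r" and \<phi>: "\<phi> \<in> X0s s \<Omega>"
  shows "\<bar>source_form \<Omega> a K Q q lam u \<phi> - source_form \<Omega> a K Q q lam v \<phi>\<bar>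
    \<le> ((CS 2)\<^sup>2 * (Linf_norm \<Omega> a + measure lebesgue \<Omega> * Linf_norm (\<Omega> \<times> \<Omega>) K)
        + \<bar>lam\<bar> * (Linf_norm (\<Omega> \<times> \<Omega>) Q *
          ((q - 1) * 2 powr (q - 2) + q * 2 powr (q - 1)) * CS q powr (2 * q)) * r powr (2 * q - 2))
      * X0s_norm s (\<lambda>x. u x - v x) * X0s_norm s \<phi>"
proof -
  let ?M = "lebesgue_on \<Omega>" and ?w = "\<lambda>x. u x - v x"
  let ?k = "Linf_norm (\<Omega> \<times> \<Omega>) Q" and ?c = "(q - 1) * 2 powr (q - 2) + q * 2 powr (q - 1)"
  have w: "?w \<in> X0s s \<Omega>" by (rule X.diff_mem[OF u(1) v(1)])
  have b: "0 < CS q * r" using CS_pos r by simp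
  note iu = source_form_integrable[OF u(1) \<phi>] and iv = source_form_integrable[OF v(1) \<phi>]
    and iw = source_form_integrable[OF w \<phi>]
  have lm: "\<Omega> \<in> lmeasurable" using open_\<Omega> bounded_\<Omega> by (intro lmeasurable_open)
  have L1: "integrable ?M u" if "u \<in> X0s s \<Omega>" for u
    by (rule integral_abs_le_L2(1)[OF lm CS_norm_nonneg(1)[OF that] X0s_L2_Lq(1)[OF that]])
  have a_diff: "(LINT x|?M. a x * u x * \<phi> x) - (LINT x|?M. a x * v x * \<phi> x)
      = (LINT x|?M. a x * ?w x * \<phi> x)"
    unfolding Bochner_Integration.integral_diff[OF iu(1) iv(1), symmetric]
    by (simp only: left_diff_distrib right_diff_distrib)
  have "(LINT x|?M. TK \<Omega> K u x * \<phi> x) - (LINT x|?M. TK \<Omega> K v x * \<phi> x)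
      = (LINT x|?M. TK \<Omega> K u x * \<phi> x - TK \<Omega> K v x * \<phi> x)"
    by (rule Bochner_Integration.integral_diff[OF iu(2) iv(2), symmetric])
  also have "\<dots> = (LINT x|?M. TK \<Omega> K ?w x * \<phi> x)"
  proof (rule integral_cong_AE)
    show "AE x in ?M. TK \<Omega> K u x * \<phi> x - TK \<Omega> K v x * \<phi> x = TK \<Omega> K ?w x * \<phi> x"
      using AE_TK_diff[OF open_\<Omega> bounded_\<Omega> K L1[OF u(1)] L1[OF v(1)]]
    proof eventually_elim
      case (elim x)
      show ?case unfolding elim[symmetric] by (rule left_diff_distrib[symmetric])
    qed
  qed (rule borel_measurable_integrable[OF Bochner_Integration.integrable_diff[OF iu(2) iv(2)]]
      borel_measurable_integrable[OF iw(2)])+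
  finally have TK_diff: "(LINT x|?M. TK \<Omega> K u x * \<phi> x) - (LINT x|?M. TK \<Omega> K v x * \<phi> x)
      = (LINT x|?M. TK \<Omega> K ?w x * \<phi> x)" .
  have "(LINT x|?M. NQ \<Omega> Q q u x * \<phi> x) - (LINT x|?M. NQ \<Omega> Q q v x * \<phi> x)
      = (LINT x|?M. (NQ \<Omega> Q q u x - NQ \<Omega> Q q v x) * \<phi> x)"
    unfolding Bochner_Integration.integral_diff[OF iu(3) iv(3), symmetric] left_diff_distrib ..
  then have "\<bar>(LINT x|?M. NQ \<Omega> Q q u x * \<phi> x) - (LINT x|?M. NQ \<Omega> Q q v x * \<phi> x)\<bar>
      \<le> ?k * ?c * (CS q * r) powr (2 * q - 2) * ((CS q * X0s_norm s ?w) * (CS q * X0s_norm s \<phi>))"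
    using NQ_diff_bound[OF open_\<Omega> bounded_\<Omega> Q q(1) b CS_norm_nonneg(2)[OF \<phi>] CS_norm_nonneg(2)[OF w]
      X0s_ball_Lq[OF u] X0s_ball_Lq[OF v] X0s_L2_Lq(2)[OF w] X0s_L2_Lq(2)[OF \<phi>]] by simp
  also have "\<dots> = ?k * ?c * (CS q powr (2 * q) * r powr (2 * q - 2) * (X0s_norm s ?w * X0s_norm s \<phi>))"
    unfolding mult.assoc[of "?k * ?c"] CS_powr_scale[OF r] ..
  finally have "\<bar>lam * ((LINT x|?M. NQ \<Omega> Q q u x * \<phi> x) - (LINT x|?M. NQ \<Omega> Q q v x * \<phi> x))\<bar>
      \<le> \<bar>lam\<bar> * (?k * ?c * (CS q powr (2 * q) * r powr (2 * q - 2) * (X0s_norm s ?w * X0s_norm s \<phi>)))"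
    unfolding abs_mult by (intro mult_left_mono) simp_all
  moreover have "source_form \<Omega> a K Q q lam u \<phi> - source_form \<Omega> a K Q q lam v \<phi>
      = (LINT x|?M. a x * ?w x * \<phi> x) + (LINT x|?M. TK \<Omega> K ?w x * \<phi> x)
        + lam * ((LINT x|?M. NQ \<Omega> Q q u x * \<phi> x) - (LINT x|?M. NQ \<Omega> Q q v x * \<phi> x))"
    unfolding source_form_eq[OF u(1) \<phi>] source_form_eq[OF v(1) \<phi>] a_diff[symmetric] TK_diff[symmetric]
    by (simp add: right_diff_distrib)
  ultimately have "\<bar>source_form \<Omega> a K Q q lam u \<phi> - source_form \<Omega> a K Q q lam v \<phi>\<bar>
      \<le> (CS 2)\<^sup>2 * (Linf_norm \<Omega> a + measure lebesgue \<Omega> * Linf_norm (\<Omega> \<times> \<Omega>) K)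
          * (X0s_norm s ?w * X0s_norm s \<phi>)
        + \<bar>lam\<bar> * (?k * ?c * (CS q powr (2 * q) * r powr (2 * q - 2) * (X0s_norm s ?w * X0s_norm s \<phi>)))"
    using linear_source_bound[OF w \<phi>] by linarith
  also have "\<dots> = ((CS 2)\<^sup>2 * (Linf_norm \<Omega> a + measure lebesgue \<Omega> * Linf_norm (\<Omega> \<times> \<Omega>) K)
      + \<bar>lam\<bar> * (?k * ?c * CS q powr (2 * q)) * r powr (2 * q - 2)) * X0s_norm s ?w * X0s_norm s \<phi>"
    by (simp only: distrib_right mult.assoc)
  finally show ?thesis .
qed

end

section \<open>Existence, uniqueness and convergence of the Picard iterates in the ball\<close>

theorem theorem4p6:
  fixes \<Omega> :: "'a::euclidean_space set"
    and s q lam r \<eta> \<gamma> CqQS \<kappa> :: real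
    and a :: "'a \<Rightarrow> real"
    and K Q :: "'a \<times> 'a \<Rightarrow> real"
    and f :: "('a \<Rightarrow> real) \<Rightarrow> real"
    and CS :: "real \<Rightarrow> real"
  assumes N: "DIM('a) \<ge> 2"
    and \<Omega>: "bounded_lipschitz_domain \<Omega>"
    and s: "0 < s" "s < 1"
    and CS: "sobolev_constants s \<Omega> CS"
    and q: "2 \<le> q" "q < crit_exp DIM('a) s"
    and a: "a \<in> Linf_space \<Omega>"
    and K: "K \<in> Linf_space (\<Omega> \<times> \<Omega>)"
    and Q: "Q \<in> Linf_space (\<Omega> \<times> \<Omega>)"
    and f: "f \<in> X0s_dual s \<Omega>"
    and eta: "\<eta> = (CS 2)\<^sup>2 * (Linf_norm \<Omega> a + measure lebesgue \<Omega> * Linf_norm (\<Omega> \<times> \<Omega>) K)"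
    and gamma: "\<gamma> = \<bar>lam\<bar> * Linf_norm (\<Omega> \<times> \<Omega>) Q * CS q powr (2 * q)"
    and CqQS: "CqQS = Linf_norm (\<Omega> \<times> \<Omega>) Q *
      ((q - 1) * 2 powr (q - 2) + q * 2 powr (q - 1)) * CS q powr (2 * q)"
    and r: "r > 0"
    and small: "\<gamma> * r powr (2 * q - 2) + X0s_dual_norm s \<Omega> f / r \<le> 1 - \<eta>"
    and kappa: "\<kappa> = \<eta> + \<bar>lam\<bar> * CqQS * r powr (2 * q - 2)"
    and contr: "\<kappa> < 1"
  shows "\<exists>u' \<in> X0s_ball s \<Omega> r.
      weak_solution s \<Omega> a K Q q lam f u' \<and>
      (\<forall>v \<in> X0s_ball s \<Omega> r. weak_solution s \<Omega> a K Q q lam f v \<longrightarrow> (AE x in lebesgue. v x = u' x)) \<and>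
      (\<forall>u. u 0 \<in> X0s_ball s \<Omega> r \<and> (\<forall>n. u (Suc n) = sol_op s \<Omega> a K Q q lam f (u n)) \<longrightarrow>
        (\<forall>n. u n \<in> X0s_ball s \<Omega> r) \<and>
        (\<lambda>n. X0s_norm s (\<lambda>x. u n x - u' x)) \<longlonglongrightarrow> 0 \<and>
        (0 < \<kappa> \<longrightarrow> (\<forall>n. X0s_norm s (\<lambda>x. u n x - u' x)
            \<le> \<kappa> ^ n / (1 - \<kappa>) * X0s_norm s (\<lambda>x. u 1 x - u 0 x))) \<and>
        (\<kappa> = 0 \<longrightarrow> (AE x in lebesgue. u 1 x = u' x)))"
proof -
  have \<Omega>': "open \<Omega>" "bounded \<Omega>" using \<Omega> by (simp_all add: bounded_lipschitz_domain_def)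
  note ctx = N \<Omega>' s CS
  interpret X: complete_form "X0s s \<Omega>" "Es s"
    by (rule complete_form_X0s[OF ctx])
  have nrm: "X.nrm = X0s_norm s" by (simp add: fun_eq_iff X.nrm_def X0s_norm_def)
  have ball: "X0s_ball s \<Omega> r = {u \<in> X0s s \<Omega>. X.nrm u \<le> r}" by (simp add: X0s_ball_def nrm)
  let ?g = "source_form \<Omega> a K Q q lam"
  define S where "S = (\<lambda>u w. w \<in> X0s s \<Omega> \<and> (\<forall>\<phi>\<in>X0s s \<Omega>. Es s w \<phi> = ?g u \<phi> + f \<phi>))"
  have \<kappa>: "0 \<le> \<kappa>"
    unfolding kappa eta CqQS
    using Linf_norm_nonneg[OF a] Linf_norm_nonneg[OF K] Linf_norm_nonneg[OF Q] q
    by (intro add_nonneg_nonneg mult_nonneg_nonneg) simp_all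
  have f_lin: "f (\<lambda>x. u x + c * v x) = f u + c * f v" if "u \<in> X0s s \<Omega>" "v \<in> X0s s \<Omega>" for u v c
  proof -
    have f': "\<forall>u\<in>X0s s \<Omega>. \<forall>v\<in>X0s s \<Omega>. f (\<lambda>x. u x + v x) = f u + f v"
        "\<forall>c. \<forall>u\<in>X0s s \<Omega>. f (\<lambda>x. c * u x) = c * f u"
      using f unfolding X0s_dual_def by blast+
    have "f (\<lambda>x. u x + c * v x) = f u + f (\<lambda>x. c * v x)"
      by (rule f'(1)[rule_format, OF that(1) X.scale_mem[OF that(2)]])
    also have "f (\<lambda>x. c * v x) = c * f v"
      by (rule f'(2)[rule_format, OF that(2)])
    finally show ?thesis .
  qed
  have f_le: "\<bar>f u\<bar> \<le> X0s_dual_norm s \<Omega> f * X.nrm u" if "u \<in> X0s s \<Omega>" for u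
    unfolding nrm by (rule X0s_dual_le[OF X.semi_inner_form_axioms f that])
  have bound: "\<bar>?g u \<phi> + f \<phi>\<bar> \<le> r * X.nrm \<phi>"
    if "u \<in> X0s_ball s \<Omega> r" "\<phi> \<in> X0s s \<Omega>" for u \<phi>
  proof -
    have u: "u \<in> X0s s \<Omega>" "X0s_norm s u \<le> r" using that by (auto simp: X0s_ball_def)
    have "\<bar>?g u \<phi> + f \<phi>\<bar> \<le> (\<eta> + \<gamma> * r powr (2 * q - 2)) * r * X.nrm \<phi> + X0s_dual_norm s \<Omega> f * X.nrm \<phi>"
      using source_form_bound[OF ctx q a K Q u r that(2), of lam] f_le[OF that(2)]
      unfolding eta gamma nrm by linarith
    \<comment> \<open>Factoring out \<open>r\<close> makes the left-hand side of the first smallness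
      condition appear.\<close>
    also have "\<dots> = ((\<gamma> * r powr (2 * q - 2) + X0s_dual_norm s \<Omega> f / r) + \<eta>) * r * X.nrm \<phi>"
      using r by (simp add: field_simps)
    also have "\<dots> \<le> 1 * r * X.nrm \<phi>"
      using small r X.nrm_nonneg[OF that(2)] by (intro mult_right_mono) simp_all
    finally show ?thesis by simp
  qed
  have ex: "\<exists>w. S u w" if "u \<in> X0s_ball s \<Omega> r" for u
  proof -
    have u: "u \<in> X0s s \<Omega>" using that by (simp add: X0s_ball_def)
    have "\<exists>w\<in>X0s s \<Omega>. \<forall>\<phi>\<in>X0s s \<Omega>. Es s w \<phi> = ?g u \<phi> + f \<phi>"
    proof (rule X.Riesz_representation)
      show "?g u (\<lambda>x. \<phi> x + c * \<psi> x) + f (\<lambda>x. \<phi> x + c * \<psi> x) = ?g u \<phi> + f \<phi> + c * (?g u \<psi> + f \<psi>)"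
        if "\<phi> \<in> X0s s \<Omega>" "\<psi> \<in> X0s s \<Omega>" for \<phi> \<psi> c
        unfolding f_lin[OF that] source_form_lin[OF ctx q a K Q u that] by (simp add: distrib_left)
      show "\<bar>?g u \<phi> + f \<phi>\<bar> \<le> r * X.nrm \<phi>" if "\<phi> \<in> X0s s \<Omega>" for \<phi>
        by (rule bound) fact+
    qed
    then show ?thesis unfolding S_def by blast
  qed
  \<comment> \<open>Both energy estimates below end with a squared norm on the left; this cancels
    one factor without assuming it nonzero.\<close>
  have le_if_square_le: "t \<le> c" if "t\<^sup>2 \<le> c * t" "0 \<le> c" for t c :: real
    using that by (cases "t \<le> 0") (auto simp: power2_eq_square)
  have self: "w \<in> X0s_ball s \<Omega> r" if "u \<in> X0s_ball s \<Omega> r" "S u w" for u w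
  proof -
    have w: "w \<in> X0s s \<Omega>" and E: "Es s w w = ?g u w + f w" using that(2) by (auto simp: S_def)
    have "(X.nrm w)\<^sup>2 \<le> r * X.nrm w"
      unfolding X.nrm_square[OF w] E using bound[OF that(1) w] by linarith
    then have "X.nrm w \<le> r" by (rule le_if_square_le) (use r in simp)
    then show ?thesis using w by (simp add: ball)
  qed
  have contr': "X.nrm (\<lambda>x. w x - z x) \<le> \<kappa> * X.nrm (\<lambda>x. u x - v x)"
    if "u \<in> X0s_ball s \<Omega> r" "v \<in> X0s_ball s \<Omega> r" "S u w" "S v z" for u v w z
  proof -
    have u: "u \<in> X0s s \<Omega>" "X0s_norm s u \<le> r" and v: "v \<in> X0s s \<Omega>" "X0s_norm s v \<le> r"
      using that(1,2) by (auto simp: X0s_ball_def)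
    have wz: "w \<in> X0s s \<Omega>" "z \<in> X0s s \<Omega>" using that(3,4) by (auto simp: S_def)
    let ?d = "\<lambda>x. w x - z x"
    have d: "?d \<in> X0s s \<Omega>" by (rule X.diff_mem[OF wz])
    have "(X.nrm ?d)\<^sup>2 = Es s w ?d - Es s z ?d"
      unfolding X.nrm_square[OF d] by (rule X.E_diff[OF wz d])
    also have "\<dots> = ?g u ?d - ?g v ?d"
      using that(3,4) d by (simp add: S_def)
    also have "\<dots> \<le> \<kappa> * X.nrm (\<lambda>x. u x - v x) * X.nrm ?d"
      using source_form_diff_bound[OF ctx q a K Q u v r d, of lam]
      unfolding kappa eta CqQS nrm by linarith
    finally show ?thesis
      by (rule le_if_square_le)
        (intro mult_nonneg_nonneg \<kappa> X.nrm_nonneg X.diff_mem u v)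
  qed
  \<comment> \<open>By Cauchy-Schwarz, functions at distance zero define the same functional on the
    test space.\<close>
  have cong: "S u z" if "u \<in> X0s_ball s \<Omega> r" "S u w" "z \<in> X0s s \<Omega>" "X.nrm (\<lambda>x. w x - z x) = 0" for u w z
    unfolding S_def
  proof (intro conjI ballI)
    fix \<phi> assume \<phi>: "\<phi> \<in> X0s s \<Omega>"
    have w: "w \<in> X0s s \<Omega>" using that(2) by (simp add: S_def)
    have "Es s w \<phi> - Es s z \<phi> = 0"
      using X.Cauchy_Schwarz[OF X.diff_mem[OF w that(3)] \<phi>] that(4)
      unfolding X.E_diff[OF w that(3) \<phi>] by simp
    then show "Es s z \<phi> = ?g u \<phi> + f \<phi>" using that(2) \<phi> by (simp add: S_def)
  qed (rule that(3))
  \<comment> \<open>The predicate under the choice in \<open>sol_op\<close> is \<open>S u\<close>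
    unfolded, so existence of some value settles the chosen one.\<close>
  have sol: "S u (sol_op s \<Omega> a K Q q lam f u)" if "u \<in> X0s_ball s \<Omega> r" for u
    using someI_ex[OF ex[OF that]] unfolding S_def sol_op_def source_form_def .
  have weak: "weak_solution s \<Omega> a K Q q lam f u \<longleftrightarrow> S u u" if "u \<in> X0s s \<Omega>" for u
  proof -
    have "As s \<Omega> a K u \<phi> = lam * (LINT x|lebesgue_on \<Omega>. NQ \<Omega> Q q u x * \<phi> x) + f \<phi>
        \<longleftrightarrow> Es s u \<phi> = ?g u \<phi> + f \<phi>" if "\<phi> \<in> X0s s \<Omega>" for \<phi>
      unfolding As_def source_form_eq[OF ctx q a K Q \<open>u \<in> X0s s \<Omega>\<close> that] by linarith
    then show ?thesis unfolding weak_solution_def S_def by blast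
  qed
  have AE_eq: "AE x in lebesgue. u x = v x"
    if "u \<in> X0s s \<Omega>" "v \<in> X0s s \<Omega>" "X.nrm (\<lambda>x. u x - v x) = 0" for u v
    using X0s_norm_eq_0[OF ctx X.diff_mem[OF that(1,2)]] that(3) by (simp add: nrm)
  have "\<exists>v\<in>X0s_ball s \<Omega> r. S v v \<and>
    (\<forall>w\<in>X0s_ball s \<Omega> r. S w w \<longrightarrow> X.nrm (\<lambda>x. w x - v x) = 0) \<and>
    (\<forall>u n. u 0 \<in> X0s_ball s \<Omega> r \<longrightarrow> (\<forall>n. u n \<in> X0s_ball s \<Omega> r \<longrightarrow> S (u n) (u (Suc n))) \<longrightarrow>
      u n \<in> X0s_ball s \<Omega> r \<and> X.nrm (\<lambda>x. u n x - v x) \<le> \<kappa> ^ n * X.nrm (\<lambda>x. u 0 x - v x))"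
    unfolding ball
    by (rule X.contraction_iteration[OF less_imp_le[OF r] \<kappa> contr], fold ball)
      (fact ex self contr' cong)+
  then obtain u' where u': "u' \<in> X0s_ball s \<Omega> r" "S u' u'"
    and uniq: "\<And>w. w \<in> X0s_ball s \<Omega> r \<Longrightarrow> S w w \<Longrightarrow> X.nrm (\<lambda>x. w x - u' x) = 0"
    and iter: "\<And>u n. u 0 \<in> X0s_ball s \<Omega> r \<Longrightarrow>
      \<forall>n. u n \<in> X0s_ball s \<Omega> r \<longrightarrow> S (u n) (u (Suc n)) \<Longrightarrow>
      u n \<in> X0s_ball s \<Omega> r \<and> X.nrm (\<lambda>x. u n x - u' x) \<le> \<kappa> ^ n * X.nrm (\<lambda>x. u 0 x - u' x)"
    by blast
  have u'V: "u' \<in> X0s s \<Omega>" using u' by (simp add: ball)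
  show ?thesis
  proof (intro bexI[OF _ u'(1)] conjI ballI allI impI)
    show "weak_solution s \<Omega> a K Q q lam f u'" using weak[OF u'V] u'(2) by simp
  next
    fix v assume v: "v \<in> X0s_ball s \<Omega> r" "weak_solution s \<Omega> a K Q q lam f v"
    then have "v \<in> X0s s \<Omega>" by (simp add: ball)
    then show "AE x in lebesgue. v x = u' x"
      using v weak by (intro AE_eq u'V uniq) simp_all
  next
    fix u assume "u 0 \<in> X0s_ball s \<Omega> r \<and> (\<forall>n. u (Suc n) = sol_op s \<Omega> a K Q q lam f (u n))"
    then have u0: "u 0 \<in> X0s_ball s \<Omega> r" and uS: "\<And>n. u (Suc n) = sol_op s \<Omega> a K Q q lam f (u n)"
      by auto
    have step: "\<forall>n. u n \<in> X0s_ball s \<Omega> r \<longrightarrow> S (u n) (u (Suc n))"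
      unfolding uS using sol by blast
    have mem: "u n \<in> X0s_ball s \<Omega> r"
      and le: "X.nrm (\<lambda>x. u n x - u' x) \<le> \<kappa> ^ n * X.nrm (\<lambda>x. u 0 x - u' x)" for n
      using iter[of u n, OF u0 step] by auto
    have V: "u n \<in> X0s s \<Omega>" for n using mem[of n] by (simp add: ball)
    show "u n \<in> X0s_ball s \<Omega> r" for n by (rule mem)
    show "(\<lambda>n. X0s_norm s (\<lambda>x. u n x - u' x)) \<longlonglongrightarrow> 0"
    proof (rule Lim_null_comparison)
      show "eventually (\<lambda>n. norm (X0s_norm s (\<lambda>x. u n x - u' x)) \<le> \<kappa> ^ n * X.nrm (\<lambda>x. u 0 x - u' x)) sequentially"
        using le X.nrm_nonneg[OF X.diff_mem[OF V u'V]] by (simp add: nrm)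
      have "(\<lambda>n. \<kappa> ^ n) \<longlonglongrightarrow> 0" using \<kappa> contr by (intro LIMSEQ_power_zero) simp
      then show "(\<lambda>n. \<kappa> ^ n * X.nrm (\<lambda>x. u 0 x - u' x)) \<longlonglongrightarrow> 0"
        by (rule tendsto_mult_left_zero)
    qed
    show "X0s_norm s (\<lambda>x. u n x - u' x) \<le> \<kappa> ^ n / (1 - \<kappa>) * X0s_norm s (\<lambda>x. u 1 x - u 0 x)"
      if "0 < \<kappa>" for n
    proof -
      let ?d = "X.nrm (\<lambda>x. u 0 x - u' x)"
      \<comment> \<open>The unknown initial distance reappears with factor
        \<open>\<kappa> < 1\<close> and is absorbed; this is where \<open>1 / (1 - \<kappa>)\<close>
        comes from.\<close>
      have "?d \<le> X.nrm (\<lambda>x. u 1 x - u 0 x) + \<kappa> * ?d"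
        using X.nrm_triangle[OF V[of 0] V[of 1] u'V] X.nrm_minus_commute[OF V[of 0] V[of 1]] le[of 1] by simp
      then have "?d \<le> X.nrm (\<lambda>x. u 1 x - u 0 x) / (1 - \<kappa>)"
        using contr by (simp add: pos_le_divide_eq algebra_simps)
      then have "\<kappa> ^ n * ?d \<le> \<kappa> ^ n * (X.nrm (\<lambda>x. u 1 x - u 0 x) / (1 - \<kappa>))"
        using \<kappa> by (intro mult_left_mono) simp_all
      with le[of n] show ?thesis by (simp add: nrm)
    qed
    \<comment> \<open>The geometric bound is used at index \<open>1\<close>, where
      \<open>\<kappa> ^ 1 = 0\<close>; at index \<open>0\<close> it would say nothing, since
      \<open>0 ^ 0 = 1\<close>.\<close>
    show "AE x in lebesgue. u 1 x = u' x" if "\<kappa> = 0"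
      using le[of 1] that X.nrm_nonneg[OF X.diff_mem[OF V[of 1] u'V]]
      by (intro AE_eq V u'V) simp
  qed
qed

end
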